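(* For $0<\varepsilon<\infty$, $0<s<\infty$, $0<\ell<\infty$, let $\{B_t\}_{t\ge0}$ and $\{N_t\}_{t\ge0}$ be two independent standard Wiener processes, and define $X_0=0$, $X_t=B_t+st$ and $Y_0=0$, $Y_t=X_t+\varepsilon N_t$ for real $t>0$. Let $\tau_\ell=\inf\{t\ge 0: X_t\ge \ell\}$, let $\hat X_0=0$, $\hat X_t=st+\frac{1}{1+\varepsilon^2}(Y_t-st)$ for $t>0$, and let $\eta^*_\ell=\inf\{t\ge 0:\hat X_t\ge \ell\}$. Let $q$ be a constant such that $1/2<q<1$. In the asymptotic regime where $(\ell,s,\varepsilon)$ varies such that $$ s\left(\frac{\ell}{s}\right)^{q-1/2}\longrightarrow\infty,\qquad \left(\frac{\ell}{s}\right)^{1-q}\frac{\varepsilon^2}{1+\varepsilon^2}\longrightarrow\infty,\qquad s\ell\,\frac{\varepsilon^4}{(1+\varepsilon^2)^2}\longrightarrow\infty, $$ we have $$ \inf_{\eta(Y_0^\infty)}\mathbb{E}|\eta-\tau_\ell|=(1+o(1))\,\mathbb{E}|\eta^*_\ell-\tau_\ell|=\sqrt{\frac{2\ell\varepsilon^2}{\pi s^3(1+\varepsilon^{2})}}\,(1+o(1)), $$ where the infimum is over all estimators $\eta=\eta(Y_0^\infty)$, i.e. all (measurable) functions of the entire observation process $Y_0^\infty=\{Y_t\}_{t\ge0}$, not necessarily stopping times. In particular, these equalities hold in the limit $\ell\to\infty$ for fixed $0<\varepsilon<\infty$ and $0<s<\infty$.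
   Context: Time $t$ is continuous, ranging over $[0,\infty)$. Standard Wiener processes start at $0$. The symbol $o(1)$ denotes a quantity tending to $0$ in the asymptotic regime under consideration. *)

theory Defs
  imports "HOL-Probability.Probability"
begin

text \<open>
  A stochastic process is a family \<open>W t \<omega>\<close> of which only the times \<open>t \<ge> 0\<close> matter.
  Path continuity is required almost surely, which covers both usual conventions.
\<close>

definition standard_wiener :: "'a measure \<Rightarrow> (real \<Rightarrow> 'a \<Rightarrow> real) \<Rightarrow> bool" where
  "standard_wiener M W \<longleftrightarrow>
     prob_space M \<and>
     (\<forall>t\<ge>0. W t \<in> borel_measurable M) \<and>
     (\<forall>\<omega>\<in>space M. W 0 \<omega> = 0) \<and>
     (\<forall>(n::nat) t. 0 \<le> t 0 \<longrightarrow> (\<forall>i<n. t i < t (Suc i)) \<longrightarrow>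
        prob_space.indep_vars M (\<lambda>_. borel) (\<lambda>i \<omega>. W (t (Suc i)) \<omega> - W (t i) \<omega>) {..<n}) \<and>
     (\<forall>r t. 0 \<le> r \<longrightarrow> r < t \<longrightarrow>
        distributed M lborel (\<lambda>\<omega>. W t \<omega> - W r \<omega>) (normal_density 0 (sqrt (t - r)))) \<and>
     (AE \<omega> in M. continuous_on {0..} (\<lambda>t. W t \<omega>))"

definition path_space :: "(real \<Rightarrow> real) measure" where
  "path_space = (\<Pi>\<^sub>M t\<in>{0..}. borel)"

definition path :: "(real \<Rightarrow> 'a \<Rightarrow> real) \<Rightarrow> 'a \<Rightarrow> real \<Rightarrow> real" where
  "path W \<omega> = (\<lambda>t\<in>{0..}. W t \<omega>)"

definition indep_processes ::
  "'a measure \<Rightarrow> (real \<Rightarrow> 'a \<Rightarrow> real) \<Rightarrow> (real \<Rightarrow> 'a \<Rightarrow> real) \<Rightarrow> bool" where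
  "indep_processes M V W \<longleftrightarrow> prob_space.indep_var M path_space (path V) path_space (path W)"

text \<open>
  The signal \<open>X\<close>, the observation \<open>Y\<close> and the estimate of the signal. No case distinction at
  \<open>t = 0\<close> is needed, because Wiener processes start at \<open>0\<close>.
\<close>

definition signal :: "real \<Rightarrow> (real \<Rightarrow> 'a \<Rightarrow> real) \<Rightarrow> real \<Rightarrow> 'a \<Rightarrow> real" where
  "signal s B t \<omega> = B t \<omega> + s * t"

definition observation ::
  "real \<Rightarrow> real \<Rightarrow> (real \<Rightarrow> 'a \<Rightarrow> real) \<Rightarrow> (real \<Rightarrow> 'a \<Rightarrow> real) \<Rightarrow> real \<Rightarrow> 'a \<Rightarrow> real" where
  "observation s \<epsilon> B N t \<omega> = signal s B t \<omega> + \<epsilon> * N t \<omega>"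

definition signal_estimate ::
  "real \<Rightarrow> real \<Rightarrow> (real \<Rightarrow> 'a \<Rightarrow> real) \<Rightarrow> (real \<Rightarrow> 'a \<Rightarrow> real) \<Rightarrow> real \<Rightarrow> 'a \<Rightarrow> real" where
  "signal_estimate s \<epsilon> B N t \<omega> =
     s * t + 1 / (1 + \<epsilon>\<^sup>2) * (observation s \<epsilon> B N t \<omega> - s * t)"

text \<open>The infimum is taken in the extended reals, so it is \<open>\<infinity>\<close> if the level is never reached.\<close>

definition hitting_time :: "(real \<Rightarrow> 'a \<Rightarrow> real) \<Rightarrow> real \<Rightarrow> 'a \<Rightarrow> ereal" where
  "hitting_time Z l \<omega> = Inf (ereal ` {t. 0 \<le> t \<and> l \<le> Z t \<omega>})"

text \<open>
  The expectation is a nonnegative Lebesgue integral and may a priori be infinite. It does not change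
  when the integrand is altered on a null set, so paths that fail to be continuous or
  never reach the level play no role.
\<close>

definition mean_abs_error :: "'a measure \<Rightarrow> ('a \<Rightarrow> ereal) \<Rightarrow> ('a \<Rightarrow> ereal) \<Rightarrow> ennreal" where
  "mean_abs_error M S T = (\<integral>\<^sup>+ \<omega>. e2ennreal \<bar>S \<omega> - T \<omega>\<bar> \<partial>M)"

definition optimal_error ::
  "'a measure \<Rightarrow> (real \<Rightarrow> 'a \<Rightarrow> real) \<Rightarrow> (real \<Rightarrow> 'a \<Rightarrow> real) \<Rightarrow> real \<Rightarrow> real \<Rightarrow> real \<Rightarrow> ennreal" where
  "optimal_error M B N l s \<epsilon> =
     (INF \<eta> \<in> (borel_measurable path_space :: ((real \<Rightarrow> real) \<Rightarrow> ereal) set).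
        mean_abs_error M (\<lambda>\<omega>. \<eta> (path (observation s \<epsilon> B N) \<omega>)) (hitting_time (signal s B) l))"

definition hitting_error ::
  "'a measure \<Rightarrow> (real \<Rightarrow> 'a \<Rightarrow> real) \<Rightarrow> (real \<Rightarrow> 'a \<Rightarrow> real) \<Rightarrow> real \<Rightarrow> real \<Rightarrow> real \<Rightarrow> ennreal" where
  "hitting_error M B N l s \<epsilon> =
     mean_abs_error M (hitting_time (signal_estimate s \<epsilon> B N) l) (hitting_time (signal s B) l)"

definition error_rate :: "real \<Rightarrow> real \<Rightarrow> real \<Rightarrow> real" where
  "error_rate l s \<epsilon> = sqrt (2 * l * \<epsilon>\<^sup>2 / (pi * s ^ 3 * (1 + \<epsilon>\<^sup>2)))"

text \<open>
  \<open>f = (1 + o(1)) g\<close> for quantities in \<open>[0, \<infinity>]\<close>. Chaining this down to a \<open>g\<close> with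
  values in \<open>(0, \<infinity>)\<close> makes all members of the chain eventually finite and positive.
\<close>

definition asymp_eq :: "('i \<Rightarrow> ennreal) \<Rightarrow> 'i filter \<Rightarrow> ('i \<Rightarrow> ennreal) \<Rightarrow> bool" where
  "asymp_eq f F g \<longleftrightarrow> ((\<lambda>i. f i / g i) \<longlongrightarrow> 1) F"

end

theory Submission
  imports Defs
begin

text \<open>
  Write \<open>T = l / s\<close>, \<open>k = \<epsilon>\<^sup>2 / (1 + \<epsilon>\<^sup>2)\<close> and \<open>Z t = (B t + \<epsilon> * N t) / (1 + \<epsilon>\<^sup>2)\<close>, so that the estimate of the
  signal is \<open>Z t + s * t\<close> and \<open>D = B T - Z T\<close> is a centred normal variable of variance \<open>k * T\<close>. The times at
  which \<open>B t + s * t\<close> and \<open>Z t + s * t\<close> hit the level \<open>l\<close> are close to \<open>T - B T / s\<close> and \<open>T - Z T / s\<close>, whose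
  difference is \<open>D / s\<close> up to sign, and \<open>E \<bar>D\<bar> / s\<close> is exactly the claimed rate.

  The error of the linearization is controlled by a pathwise domination
  \<open>\<bar>B t - B T\<bar> \<le> b * \<bar>t - T\<bar> + V\<close> for all \<open>t\<close> at once, with \<open>E V\<close> of order \<open>1 / b\<close>, which follows from
  dyadic chaining. For the best slope \<open>b\<close> the error is the rate times a multiple of
  \<open>1 / sqrt A\<close> with \<open>A = k * sqrt (s * l)\<close>; the third hypothesis says precisely that \<open>A\<close> tends to infinity.

  No estimator beats \<open>E \<bar>D\<bar> / s\<close> because reflecting the Gaussian pair \<open>(B, N)\<close> in the direction \<open>(1, \<epsilon>)\<close>
  preserves its law and the observation but changes the sign of \<open>D\<close>: an estimator has to serve
  two equally likely targets at distance \<open>2 * \<bar>D\<bar> / s\<close>.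
\<close>

section \<open>Pathwise domination of Wiener processes\<close>

text \<open>An odd index of generation \<open>n\<close> is one increment of that generation away
  from its even left neighbour, which is already a point of generation \<open>n - 1\<close>. The way
  from \<open>0\<close> thus uses at most one increment of each generation; generation
  \<open>0\<close> covers the whole length \<open>r\<close>.\<close>

lemma dyadic_chain:
  fixes f :: "real \<Rightarrow> real" and m :: "nat \<Rightarrow> real"
  assumes m: "\<And>n k. k < 2 ^ n \<Longrightarrow> \<bar>f (r * real (Suc k) / 2 ^ n) - f (r * real k / 2 ^ n)\<bar> \<le> m n"
  shows "k \<le> 2 ^ n \<Longrightarrow> \<bar>f (r * real k / 2 ^ n) - f 0\<bar> \<le> (\<Sum>j\<le>n. m j)"
proof (induction n arbitrary: k)
  case 0
  have "0 \<le> m 0" by (rule order_trans[OF abs_ge_zero m[of 0 0]]) simp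
  moreover have "k = 0 \<or> k = 1" using 0 by auto
  ultimately show ?case using m[of 0 0] by auto
next
  case (Suc n)
  have m_nonneg: "0 \<le> m (Suc n)" using m[of 0 "Suc n"] by auto
  obtain j where j: "k = 2 * j \<or> k = Suc (2 * j)" by (metis oddE evenE Suc_eq_plus1)
  then have jn: "j \<le> 2 ^ n" using Suc.prems by auto
  have e: "r * real (2 * j) / 2 ^ Suc n = r * real j / 2 ^ n" by simp
  have IH: "\<bar>f (r * real (2 * j) / 2 ^ Suc n) - f 0\<bar> \<le> (\<Sum>j\<le>n. m j)"
    using Suc.IH[OF jn] unfolding e .
  show ?case
  proof (cases "k = 2 * j")
    case True
    then show ?thesis using IH m_nonneg by simp
  next
    case False
    then have k: "k = Suc (2 * j)" using j by simp
    then have "2 * j < 2 ^ Suc n" using Suc.prems by simp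
    from m[OF this] IH show ?thesis by (simp add: k del: of_nat_Suc power_Suc)
  qed
qed

text \<open>Splits an increment into a deterministic allowance \<open>a\<close> and an excess paid
  for by the fourth power, so that sums of moments can replace maxima in the chaining.\<close>

lemma le_add_fourth_power:
  fixes a x :: real
  assumes "0 < a"
  shows "\<bar>x\<bar> \<le> a + x ^ 4 / a ^ 3"
proof (cases "\<bar>x\<bar> \<le> a")
  case True
  then show ?thesis using assms by (intro order_trans[OF True]) simp
next
  case False
  have "\<bar>x\<bar> * a ^ 3 \<le> \<bar>x\<bar> * \<bar>x\<bar> ^ 3"
    using False assms by (intro mult_left_mono power_mono) auto
  also have "\<dots> = x ^ 4"
    using power_even_abs_numeral[of "num.Bit0 (num.Bit0 num.One)" x]
    by (simp add: power_Suc[symmetric] del: power_Suc)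
  finally have "\<bar>x\<bar> \<le> x ^ 4 / a ^ 3" using assms by (simp add: field_simps)
  then show ?thesis using assms by simp
qed

text \<open>Dyadic points are dense in the interval, so continuity carries a bound that is uniform
  over all generations to every \<open>u\<close>. The bound \<open>c\<close> is extended because the
  chaining variable may be infinite.\<close>

lemma dyadic_approx:
  fixes f :: "real \<Rightarrow> real"
  assumes f: "continuous_on {0..} f" and r: "0 < r"
    and b: "\<And>n k. k \<le> 2 ^ n \<Longrightarrow> ennreal \<bar>f (r * real k / 2 ^ n) - f 0\<bar> \<le> c"
    and u: "0 \<le> u" "u \<le> r"
  shows "ennreal \<bar>f u - f 0\<bar> \<le> c"
proof -
  \<comment> \<open>Rounding down keeps the approximating points inside the interval, at most
    \<open>r / 2 ^ n\<close> below \<open>u\<close>.\<close>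
  define k where "k n = nat \<lfloor>u / r * 2 ^ n\<rfloor>" for n
  define d where "d n = r * real (k n) / 2 ^ n" for n
  have k: "real (k n) \<le> u / r * 2 ^ n" "u / r * 2 ^ n - 1 \<le> real (k n)" for n
    using u r unfolding k_def by (auto simp: of_nat_floor)
  have "u / r * 2 ^ n \<le> 2 ^ n" for n
    using u r by (simp add: field_simps)
  then have k2: "k n \<le> 2 ^ n" for n
    using k(1)[of n] by (metis (no_types, opaque_lifting) of_nat_le_iff of_nat_numeral of_nat_power order_trans)
  have d1: "d n \<le> u" "u - r / 2 ^ n \<le> d n" for n
  proof -
    have "r * real (k n) \<le> r * (u / r * 2 ^ n)" using k r by (intro mult_left_mono) auto
    then show "d n \<le> u" using r by (simp add: d_def field_simps)
    have "r * (u / r * 2 ^ n - 1) \<le> r * real (k n)" using k r by (intro mult_left_mono) auto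
    then have "u * 2 ^ n - r \<le> r * real (k n)" using r by (simp add: right_diff_distrib)
    then have "(u * 2 ^ n - r) / 2 ^ n \<le> d n" unfolding d_def by (intro divide_right_mono) auto
    then show "u - r / 2 ^ n \<le> d n" by (simp add: diff_divide_distrib)
  qed
  have "(\<lambda>n. r / 2 ^ n) \<longlonglongrightarrow> 0" by (rule LIMSEQ_divide_realpow_zero) simp
  then have "(\<lambda>n. u - r / 2 ^ n) \<longlonglongrightarrow> u - 0" by (intro tendsto_intros)
  then have du: "d \<longlonglongrightarrow> u"
    using d1 by (intro real_tendsto_sandwich[where f="\<lambda>n. u - r / 2 ^ n" and h="\<lambda>_. u" and g=d]) auto
  have "\<forall>n. d n \<in> {0..}" using r by (auto simp: d_def)
  then have "(\<lambda>n. f (d n)) \<longlonglongrightarrow> f u"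
    using f du u unfolding continuous_on_sequentially by (auto simp: comp_def)
  then have lim: "(\<lambda>n. ennreal \<bar>f (d n) - f 0\<bar>) \<longlonglongrightarrow> ennreal \<bar>f u - f 0\<bar>"
    by (intro tendsto_intros tendsto_ennrealI)
  have "ennreal \<bar>f (d n) - f 0\<bar> \<le> c" for n
    unfolding d_def by (rule b[OF k2])
  then show ?thesis by (intro LIMSEQ_le_const2[OF lim]) auto
qed

text \<open>
  The weights decay slower than \<open>2 ^ (- n / 3)\<close>, so that the fourth moments of the \<open>2 ^ n\<close> increments
  of generation \<open>n\<close> remain summable.
\<close>

lemma chaining:
  fixes f :: "real \<Rightarrow> 'a \<Rightarrow> real"
  assumes meas: "\<And>u. 0 \<le> u \<Longrightarrow> f u \<in> borel_measurable M"
    and mom: "\<And>u v. 0 \<le> u \<Longrightarrow> u < v \<Longrightarrow> (\<integral>\<^sup>+\<omega>. ennreal ((f v \<omega> - f u \<omega>) ^ 4) \<partial>M) \<le> ennreal (3 * (v - u)\<^sup>2)"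
    and cont: "AE \<omega> in M. continuous_on {0..} (\<lambda>t. f t \<omega>)"
    and r: "0 < r" and a: "0 < a"
  shows "\<exists>V\<in>borel_measurable M. (\<integral>\<^sup>+\<omega>. V \<omega> \<partial>M) \<le> ennreal (6144 * r\<^sup>2 / a ^ 3) \<and>
    (AE \<omega> in M. \<forall>u. 0 \<le> u \<longrightarrow> u \<le> r \<longrightarrow> ennreal \<bar>f u \<omega> - f 0 \<omega>\<bar> \<le> ennreal a + V \<omega>)"
proof -
  \<comment> \<open>The factor \<open>1 / 8\<close> makes the geometric weights sum to exactly
    \<open>a\<close>.\<close>
  define w where "w n = a / 8 * (7 / 8) ^ n" for n :: nat
  have w: "0 < w n" for n using a by (simp add: w_def)
  have "(\<lambda>n. (7 / 8 :: real) ^ n) sums (1 / (1 - 7 / 8))" by (rule geometric_sums) simp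
  from sums_mult[OF this, of "a / 8"] have w_sums: "w sums a" by (simp add: w_def[abs_def])
  \<comment> \<open>The excess of an increment over the weight of its generation, in the sense of
    \<open>le_add_fourth_power\<close>.\<close>
  define D where "D n k \<omega> = (f (r * real (Suc k) / 2 ^ n) \<omega> - f (r * real k / 2 ^ n) \<omega>) ^ 4 / w n ^ 3"
    for n k \<omega>
  have D_nonneg: "0 \<le> D n k \<omega>" for n k \<omega> using w[of n] by (simp add: D_def)
  have [measurable]: "D n k \<in> borel_measurable M" for n k
  proof -
    have [measurable]: "f (r * real (Suc k) / 2 ^ n) \<in> borel_measurable M"
      "f (r * real k / 2 ^ n) \<in> borel_measurable M"
      using r by (auto intro!: meas simp del: of_nat_Suc)
    show ?thesis unfolding D_def by measurable
  qed
  define V where "V \<omega> = (\<Sum>n. \<Sum>k<2 ^ n. ennreal (D n k \<omega>))" for \<omega>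
  have V: "V \<in> borel_measurable M" unfolding V_def by measurable
  have intD: "(\<integral>\<^sup>+\<omega>. ennreal (D n k \<omega>) \<partial>M) \<le> ennreal (3 * (r / 2 ^ n)\<^sup>2 / w n ^ 3)" for n k
  proof -
    let ?u = "r * real k / 2 ^ n" and ?v = "r * real (Suc k) / 2 ^ n"
    have [measurable]: "f ?v \<in> borel_measurable M" "f ?u \<in> borel_measurable M"
      using r by (auto intro!: meas simp del: of_nat_Suc)
    have uv: "?v - ?u = r / 2 ^ n" by (simp add: field_simps)
    have "(\<integral>\<^sup>+\<omega>. ennreal (D n k \<omega>) \<partial>M)
        = (\<integral>\<^sup>+\<omega>. ennreal (1 / w n ^ 3) * ennreal ((f ?v \<omega> - f ?u \<omega>) ^ 4) \<partial>M)"
      using w[of n] by (intro nn_integral_cong) (simp add: D_def ennreal_mult[symmetric])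
    also have "\<dots> = ennreal (1 / w n ^ 3) * (\<integral>\<^sup>+\<omega>. ennreal ((f ?v \<omega> - f ?u \<omega>) ^ 4) \<partial>M)"
      by (rule nn_integral_cmult) measurable
    also have "\<dots> \<le> ennreal (1 / w n ^ 3) * ennreal (3 * (?v - ?u)\<^sup>2)"
      using r by (intro mult_left_mono mom) (auto simp: divide_strict_right_mono)
    also have "\<dots> = ennreal (3 * (r / 2 ^ n)\<^sup>2 / w n ^ 3)"
      unfolding uv using w[of n] by (simp add: ennreal_mult[symmetric])
    finally show ?thesis .
  qed
  \<comment> \<open>The ratio is \<open>2 * (1 / 2) ^ 2 * (8 / 7) ^ 3\<close>: twice as many
    increments, half the length squared, and the inverse cube of the weight. The constant
    \<open>1536\<close> is \<open>3 * 8 ^ 3\<close>.\<close>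
  have gen: "2 ^ n * (3 * (r / 2 ^ n)\<^sup>2 / w n ^ 3) = 1536 * r\<^sup>2 / a ^ 3 * (256 / 343) ^ n" for n
  proof -
    have "(256 / 343 :: real) ^ n = (2 * (1 / 2) ^ 2 * (8 / 7) ^ 3) ^ n"
      by (simp add: power2_eq_square power3_eq_cube)
    also have "\<dots> = 2 ^ n * ((1 / 2) ^ n) ^ 2 * ((8 / 7) ^ n) ^ 3"
      unfolding power_mult_distrib power_mult[symmetric] by (simp only: mult.commute)
    also have "\<dots> = 2 ^ n * (1 / 2 ^ n)\<^sup>2 * (8 ^ n / 7 ^ n) ^ 3"
      by (simp add: power_divide)
    finally have "(256 / 343 :: real) ^ n = 2 ^ n * (1 / 2 ^ n)\<^sup>2 * (8 ^ n / 7 ^ n) ^ 3" .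
    then show ?thesis using a by (simp add: w_def power_divide power_mult_distrib field_simps)
  qed
  have "(\<lambda>n. (256 / 343 :: real) ^ n) sums (1 / (1 - 256 / 343))" by (rule geometric_sums) simp
  from sums_mult[OF this, of "1536 * r\<^sup>2 / a ^ 3"]
  have gs: "(\<lambda>n. 1536 * r\<^sup>2 / a ^ 3 * (256 / 343) ^ n) sums (1536 * r\<^sup>2 / a ^ 3 * (343 / 87))" by simp
  have "(\<integral>\<^sup>+\<omega>. V \<omega> \<partial>M) = (\<Sum>n. \<Sum>k<2 ^ n. \<integral>\<^sup>+\<omega>. ennreal (D n k \<omega>) \<partial>M)"
    unfolding V_def by (simp add: nn_integral_suminf nn_integral_sum)
  also have "\<dots> \<le> (\<Sum>n. ennreal (1536 * r\<^sup>2 / a ^ 3 * (256 / 343) ^ n))"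
  proof (intro suminf_le summableI)
    fix n
    have "(\<Sum>k<2 ^ n. \<integral>\<^sup>+\<omega>. ennreal (D n k \<omega>) \<partial>M) \<le> (\<Sum>k<(2::nat) ^ n. ennreal (3 * (r / 2 ^ n)\<^sup>2 / w n ^ 3))"
      by (intro sum_mono intD)
    also have "\<dots> = ennreal (\<Sum>k<(2::nat) ^ n. 3 * (r / 2 ^ n)\<^sup>2 / w n ^ 3)"
      using w[of n] by (intro sum_ennreal) simp
    also have "\<dots> = ennreal (2 ^ n * (3 * (r / 2 ^ n)\<^sup>2 / w n ^ 3))"
      by simp
    finally show "(\<Sum>k<2 ^ n. \<integral>\<^sup>+\<omega>. ennreal (D n k \<omega>) \<partial>M) \<le> ennreal (1536 * r\<^sup>2 / a ^ 3 * (256 / 343) ^ n)"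
      unfolding gen .
  qed
  also have "\<dots> = ennreal (1536 * r\<^sup>2 / a ^ 3 * (343 / 87))"
    using gs a by (intro suminf_ennreal_eq) auto
  \<comment> \<open>Here \<open>343 / 87 < 4\<close> and \<open>6144 = 4 * 1536\<close>.\<close>
  also have "\<dots> \<le> ennreal (6144 * r\<^sup>2 / a ^ 3)"
    using a by (intro ennreal_leI) (simp add: field_simps)
  finally have intV: "(\<integral>\<^sup>+\<omega>. V \<omega> \<partial>M) \<le> ennreal (6144 * r\<^sup>2 / a ^ 3)" .
  have dy: "ennreal \<bar>f (r * real k / 2 ^ n) \<omega> - f 0 \<omega>\<bar> \<le> ennreal a + V \<omega>" if k: "k \<le> 2 ^ n" for n k \<omega>
  proof -
    define m where "m n = w n + (\<Sum>k<2 ^ n. D n k \<omega>)" for n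
    have "\<bar>f (r * real k / 2 ^ n) \<omega> - f 0 \<omega>\<bar> \<le> (\<Sum>j\<le>n. m j)"
    proof (rule dyadic_chain[OF _ k, where f="\<lambda>u. f u \<omega>"])
      fix n k :: nat assume "k < 2 ^ n"
      \<comment> \<open>Summing the excesses of a whole generation bounds all of its increments at
        once, as \<open>dyadic_chain\<close> wants a single bound per generation.\<close>
      then have "D n k \<omega> \<le> (\<Sum>k<2 ^ n. D n k \<omega>)" by (intro member_le_sum) (auto simp: D_nonneg)
      with le_add_fourth_power[OF w[of n]]
      show "\<bar>f (r * real (Suc k) / 2 ^ n) \<omega> - f (r * real k / 2 ^ n) \<omega>\<bar> \<le> m n"
        unfolding m_def D_def by (meson add_left_mono order_trans)
    qed
    also have "\<dots> = (\<Sum>j\<le>n. w j) + (\<Sum>j\<le>n. \<Sum>k<2 ^ j. D j k \<omega>)"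
      by (simp add: m_def sum.distrib)
    also have "\<dots> \<le> a + (\<Sum>j\<le>n. \<Sum>k<2 ^ j. D j k \<omega>)"
    proof -
      have "(\<Sum>j\<le>n. w j) \<le> suminf w"
        by (intro sum_le_suminf sums_summable[OF w_sums]) (auto intro: less_imp_le w)
      then show ?thesis using sums_unique[OF w_sums] by simp
    qed
    finally have "ennreal \<bar>f (r * real k / 2 ^ n) \<omega> - f 0 \<omega>\<bar>
        \<le> ennreal (a + (\<Sum>j\<le>n. \<Sum>k<2 ^ j. D j k \<omega>))" by (rule ennreal_leI)
    also have "\<dots> = ennreal a + (\<Sum>j\<le>n. \<Sum>k<2 ^ j. ennreal (D j k \<omega>))"
      using a by (simp add: D_nonneg sum_nonneg)
    also have "\<dots> \<le> ennreal a + V \<omega>"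
      unfolding V_def by (intro add_left_mono sum_le_suminf) auto
    finally show ?thesis .
  qed
  have "AE \<omega> in M. \<forall>u. 0 \<le> u \<longrightarrow> u \<le> r \<longrightarrow> ennreal \<bar>f u \<omega> - f 0 \<omega>\<bar> \<le> ennreal a + V \<omega>"
    using cont
  proof eventually_elim
    case (elim \<omega>)
    show ?case using dyadic_approx[OF elim r dy] by blast
  qed
  then show ?thesis using V intV by blast
qed

text \<open>The half-line is covered by intervals from \<open>0\<close> to \<open>r k\<close> of
  doubling length, starting at the scale \<open>1 / b\<^sup>2\<close> on which typical fluctuations
  and a drift of slope \<open>b\<close> are comparable. On each interval \<open>chaining\<close>
  receives an allowance that the line \<open>b * u\<close> can pay in the right half, and the
  expected excesses form a geometric series.\<close>

lemma (in prob_space) drift_domination: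
  fixes f :: "real \<Rightarrow> 'a \<Rightarrow> real"
  assumes meas: "\<And>u. 0 \<le> u \<Longrightarrow> f u \<in> borel_measurable M"
    and mom: "\<And>u v. 0 \<le> u \<Longrightarrow> u < v \<Longrightarrow> (\<integral>\<^sup>+\<omega>. ennreal ((f v \<omega> - f u \<omega>) ^ 4) \<partial>M) \<le> ennreal (3 * (v - u)\<^sup>2)"
    and cont: "AE \<omega> in M. continuous_on {0..} (\<lambda>t. f t \<omega>)"
    and b: "0 < b"
  shows "\<exists>V\<in>borel_measurable M. (\<integral>\<^sup>+\<omega>. V \<omega> \<partial>M) \<le> ennreal (10 ^ 5 / b) \<and>
    (AE \<omega> in M. \<forall>u\<ge>0. ennreal \<bar>f u \<omega> - f 0 \<omega>\<bar> \<le> ennreal (b * u) + V \<omega>)"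
proof -
  define r where "r k = 2 ^ k / b\<^sup>2" for k :: nat
  define a where "a k = 2 ^ k / (2 * b)" for k :: nat
  have ra: "0 < r k" "0 < a k" for k using b by (auto simp: r_def a_def)
  have rak: "6144 * (r k)\<^sup>2 / a k ^ 3 = 49152 / b * (1 / 2) ^ k" for k
  proof -
    have "(2::real) ^ k * (2 ^ k)\<^sup>2 = (2 ^ k) ^ 3" by (simp add: power2_eq_square power3_eq_cube)
    then show ?thesis using b
      by (simp add: r_def a_def power_divide power_mult_distrib field_simps power2_eq_square power3_eq_cube)
  qed
  have "\<forall>k. \<exists>V. V \<in> borel_measurable M \<and> (\<integral>\<^sup>+\<omega>. V \<omega> \<partial>M) \<le> ennreal (49152 / b * (1 / 2) ^ k) \<and>
    (AE \<omega> in M. \<forall>u. 0 \<le> u \<longrightarrow> u \<le> r k \<longrightarrow> ennreal \<bar>f u \<omega> - f 0 \<omega>\<bar> \<le> ennreal (a k) + V \<omega>)"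
  proof
    fix k
    show "\<exists>V. V \<in> borel_measurable M \<and> (\<integral>\<^sup>+\<omega>. V \<omega> \<partial>M) \<le> ennreal (49152 / b * (1 / 2) ^ k) \<and>
      (AE \<omega> in M. \<forall>u. 0 \<le> u \<longrightarrow> u \<le> r k \<longrightarrow> ennreal \<bar>f u \<omega> - f 0 \<omega>\<bar> \<le> ennreal (a k) + V \<omega>)"
      using chaining[where f=f and M=M and r="r k" and a="a k", OF meas mom cont ra]
      unfolding rak Bex_def .
  qed
  from choice[OF this] obtain V where V[measurable]: "\<And>k. V k \<in> borel_measurable M"
    and intV: "\<And>k. (\<integral>\<^sup>+\<omega>. V k \<omega> \<partial>M) \<le> ennreal (49152 / b * (1 / 2) ^ k)"
    and AE_V: "\<And>k. AE \<omega> in M. \<forall>u. 0 \<le> u \<longrightarrow> u \<le> r k \<longrightarrow> ennreal \<bar>f u \<omega> - f 0 \<omega>\<bar> \<le> ennreal (a k) + V k \<omega>"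
    by blast
  \<comment> \<open>The summand \<open>1 / b\<close> pays for the allowance \<open>a 0\<close> near
    \<open>u = 0\<close>, where the line \<open>b * u\<close> is too small.\<close>
  define U where "U \<omega> = ennreal (1 / b) + (\<Sum>k. V k \<omega>)" for \<omega>
  have U: "U \<in> borel_measurable M" unfolding U_def by measurable
  have "(\<lambda>k. (1 / 2 :: real) ^ k) sums (1 / (1 - 1 / 2))" by (rule geometric_sums) simp
  from sums_mult[OF this, of "49152 / b"]
  have gs: "(\<lambda>k. 49152 / b * (1 / 2) ^ k) sums (98304 / b)" by simp
  have "(\<integral>\<^sup>+\<omega>. U \<omega> \<partial>M) = ennreal (1 / b) + (\<Sum>k. \<integral>\<^sup>+\<omega>. V k \<omega> \<partial>M)"
    unfolding U_def by (simp add: nn_integral_add nn_integral_suminf emeasure_space_1)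
  also have "\<dots> \<le> ennreal (1 / b) + (\<Sum>k. ennreal (49152 / b * (1 / 2) ^ k))"
    by (intro add_left_mono suminf_le intV summableI)
  also have "(\<Sum>k. ennreal (49152 / b * (1 / 2) ^ k)) = ennreal (98304 / b)"
    using gs b by (intro suminf_ennreal_eq) auto
  also have "ennreal (1 / b) + ennreal (98304 / b) \<le> ennreal (10 ^ 5 / b)"
    using b by (subst ennreal_plus[symmetric]) (auto intro!: ennreal_leI simp: field_simps)
  finally have intU: "(\<integral>\<^sup>+\<omega>. U \<omega> \<partial>M) \<le> ennreal (10 ^ 5 / b)" .
  have "AE \<omega> in M. \<forall>k u. 0 \<le> u \<longrightarrow> u \<le> r k \<longrightarrow> ennreal \<bar>f u \<omega> - f 0 \<omega>\<bar> \<le> ennreal (a k) + V k \<omega>"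
    using AE_V by (simp add: AE_all_countable)
  then have "AE \<omega> in M. \<forall>u\<ge>0. ennreal \<bar>f u \<omega> - f 0 \<omega>\<bar> \<le> ennreal (b * u) + U \<omega>"
  proof eventually_elim
    case (elim \<omega>)
    show ?case
    proof (intro allI impI)
      fix u :: real assume u: "0 \<le> u"
      \<comment> \<open>The first interval that contains \<open>u\<close>. Unless
        \<open>k = 0\<close>, minimality gives \<open>r (k - 1) < u\<close>, and \<open>a k\<close>
        is exactly \<open>b * r (k - 1)\<close>.\<close>
      define k where "k = (LEAST k. u \<le> r k)"
      have ex: "\<exists>k. u \<le> r k"
      proof -
        obtain k where "u * b\<^sup>2 < 2 ^ k" using real_arch_pow[of 2] by auto
        then show ?thesis using b by (intro exI[of _ k]) (simp add: r_def field_simps)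
      qed
      have uk: "u \<le> r k" unfolding k_def by (rule LeastI_ex[OF ex])
      have ak: "a k \<le> 1 / b + b * u"
      proof (cases k)
        case 0
        then have "a k \<le> 1 / b" using b by (simp add: a_def field_simps)
        also have "1 / b \<le> 1 / b + b * u" using b u by simp
        finally show ?thesis .
      next
        case (Suc j)
        then have "\<not> u \<le> r j" using not_less_Least[of j "\<lambda>k. u \<le> r k"] unfolding k_def by simp
        then have "b * r j \<le> b * u" using b by simp
        moreover have "a k = b * r j" using b Suc by (simp add: a_def r_def field_simps power2_eq_square)
        ultimately show ?thesis using b by (simp add: add_increasing)
      qed
      have "ennreal \<bar>f u \<omega> - f 0 \<omega>\<bar> \<le> ennreal (a k) + V k \<omega>" using elim u uk by blast
      also have "\<dots> \<le> ennreal (1 / b + b * u) + (\<Sum>k. V k \<omega>)"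
        using sum_le_suminf[of "\<lambda>k. V k \<omega>" "{k}"] ak by (intro add_mono ennreal_leI) auto
      also have "\<dots> = ennreal (b * u) + U \<omega>"
        using b u by (simp add: U_def ac_simps)
      finally show "ennreal \<bar>f u \<omega> - f 0 \<omega>\<bar> \<le> ennreal (b * u) + U \<omega>" .
    qed
  qed
  then show ?thesis using U intU by blast
qed

section \<open>Moments of centred normal variables\<close>

lemma normal_nn_integral_power4:
  assumes "distributed M lborel X (normal_density 0 \<sigma>)" and "0 < \<sigma>"
  shows "(\<integral>\<^sup>+\<omega>. ennreal (X \<omega> ^ 4) \<partial>M) = ennreal (3 * \<sigma> ^ 4)"
proof -
  have "has_bochner_integral lborel (\<lambda>x. normal_density 0 \<sigma> x * x ^ 4) (3 * \<sigma> ^ 4)"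
    using normal_moment_even[OF assms(2), of 0 2] assms(2) by (simp add: fact_numeral field_simps)
  then have "(\<integral>\<^sup>+x. ennreal (normal_density 0 \<sigma> x * x ^ 4) \<partial>lborel) = ennreal (3 * \<sigma> ^ 4)"
    by (subst nn_integral_eq_integral) (auto simp: has_bochner_integral_iff)
  moreover have "(\<integral>\<^sup>+x. ennreal (normal_density 0 \<sigma> x) * ennreal (x ^ 4) \<partial>lborel) = (\<integral>\<^sup>+\<omega>. ennreal (X \<omega> ^ 4) \<partial>M)"
    by (rule distributed_nn_integral[OF assms(1)]) simp
  ultimately show ?thesis by (simp add: ennreal_mult)
qed

lemma normal_nn_integral_abs:
  assumes "distributed M lborel X (normal_density 0 \<sigma>)" and "0 < \<sigma>"
  shows "(\<integral>\<^sup>+\<omega>. ennreal \<bar>X \<omega>\<bar> \<partial>M) = ennreal (\<sigma> * sqrt (2 / pi))"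
proof -
  have "has_bochner_integral lborel (\<lambda>x. normal_density 0 \<sigma> x * \<bar>x\<bar>) (\<sigma> * sqrt (2 / pi))"
    using normal_moment_abs_odd[OF assms(2), of 0 0] by simp
  then have "(\<integral>\<^sup>+x. ennreal (normal_density 0 \<sigma> x * \<bar>x\<bar>) \<partial>lborel) = ennreal (\<sigma> * sqrt (2 / pi))"
    by (subst nn_integral_eq_integral) (auto simp: has_bochner_integral_iff)
  moreover have "(\<integral>\<^sup>+x. ennreal (normal_density 0 \<sigma> x) * ennreal \<bar>x\<bar> \<partial>lborel) = (\<integral>\<^sup>+\<omega>. ennreal \<bar>X \<omega>\<bar> \<partial>M)"
    by (rule distributed_nn_integral[OF assms(1)]) simp
  ultimately show ?thesis by (simp add: ennreal_mult)
qed

section \<open>A single Wiener process seen from a fixed time\<close>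

locale wiener =
  fixes M :: "'a measure" and W :: "real \<Rightarrow> 'a \<Rightarrow> real"
  assumes wiener: "standard_wiener M W"
begin

sublocale prob_space M
  using wiener by (simp add: standard_wiener_def)

lemma measurable_W: "0 \<le> t \<Longrightarrow> W t \<in> borel_measurable M"
  using wiener by (simp add: standard_wiener_def)

lemma W_0: "\<omega> \<in> space M \<Longrightarrow> W 0 \<omega> = 0"
  using wiener by (simp add: standard_wiener_def)

lemma W_increment: "0 \<le> r \<Longrightarrow> r < t \<Longrightarrow>
    distributed M lborel (\<lambda>\<omega>. W t \<omega> - W r \<omega>) (normal_density 0 (sqrt (t - r)))"
  using wiener by (simp add: standard_wiener_def)

lemma W_indep: "0 \<le> t 0 \<Longrightarrow> (\<And>i. i < n \<Longrightarrow> t i < t (Suc i)) \<Longrightarrow>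
    indep_vars (\<lambda>_. borel) (\<lambda>i \<omega>. W (t (Suc i)) \<omega> - W (t i) \<omega>) {..<n}"
  using wiener by (simp add: standard_wiener_def)

lemma W_cont: "AE \<omega> in M. continuous_on {0..} (\<lambda>t. W t \<omega>)"
  using wiener by (simp add: standard_wiener_def)

lemma W_normal:
  assumes "0 < t"
  shows "distributed M lborel (W t) (normal_density 0 (sqrt t))"
proof -
  have "distributed M lborel (\<lambda>\<omega>. W t \<omega> - W 0 \<omega>) (normal_density 0 (sqrt t))"
    using W_increment[of 0 t] assms by simp
  moreover have "distr M lborel (\<lambda>\<omega>. W t \<omega> - W 0 \<omega>) = distr M lborel (W t)"
    by (intro distr_cong) (auto simp: W_0)
  ultimately show ?thesis
    using measurable_W[of t] assms by (auto simp: distributed_def)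
qed

text \<open>Stated as an inequality for times in either order, because it is applied to reversed and
  clamped times, which decrease and may coincide.\<close>

lemma W_moment4:
  assumes "0 \<le> r" "0 \<le> t"
  shows "(\<integral>\<^sup>+\<omega>. ennreal ((W t \<omega> - W r \<omega>) ^ 4) \<partial>M) \<le> ennreal (3 * (t - r)\<^sup>2)"
proof -
  have *: "(\<integral>\<^sup>+\<omega>. ennreal ((W t \<omega> - W r \<omega>) ^ 4) \<partial>M) = ennreal (3 * (t - r)\<^sup>2)" if "0 \<le> r" "r < t" for r t
  proof -
    have "sqrt (t - r) ^ 4 = (t - r)\<^sup>2"
      using that power_mult[of "sqrt (t - r)" 2 2] by simp
    then show ?thesis
      using normal_nn_integral_power4[OF W_increment[OF that]] that by simp
  qed
  consider "r < t" | "t < r" | "r = t" by linarith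
  then show ?thesis
  proof cases
    case 2
    have "(W t \<omega> - W r \<omega>) ^ 4 = (W r \<omega> - W t \<omega>) ^ 4" for \<omega>
      using power_even_abs_numeral[of "num.Bit0 (num.Bit0 num.One)"] by (metis abs_minus_commute even_numeral power_even_abs)
    then show ?thesis using *[of t r] 2 assms by (simp add: power2_commute)
  qed (use * assms in auto)
qed

text \<open>The process run forwards from \<open>T\<close> and the process run backwards from
  \<open>T\<close> until time \<open>0\<close> both satisfy the moment bound of
  \<open>drift_domination\<close>: clamping at \<open>0\<close> only shortens time differences. The
  two dominating variables are added.\<close>

lemma two_sided_drift_domination:
  assumes T: "0 \<le> T" and b: "0 < b"
  shows "\<exists>V\<in>borel_measurable M. (\<integral>\<^sup>+\<omega>. V \<omega> \<partial>M) \<le> ennreal (2 * 10 ^ 5 / b) \<and>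
    (AE \<omega> in M. \<forall>t\<ge>0. ennreal \<bar>W t \<omega> - W T \<omega>\<bar> \<le> ennreal (b * \<bar>t - T\<bar>) + V \<omega>)"
proof -
  have "\<exists>V\<in>borel_measurable M. (\<integral>\<^sup>+\<omega>. V \<omega> \<partial>M) \<le> ennreal (10 ^ 5 / b) \<and>
      (AE \<omega> in M. \<forall>u\<ge>0. ennreal \<bar>W (T + u) \<omega> - W (T + 0) \<omega>\<bar> \<le> ennreal (b * u) + V \<omega>)"
  proof (rule drift_domination[where f="\<lambda>u. W (T + u)", OF _ _ _ b])
    show "AE \<omega> in M. continuous_on {0..} (\<lambda>t. W (T + t) \<omega>)"
      using W_cont
    proof eventually_elim
      case (elim \<omega>)
      show ?case
        by (rule continuous_on_compose2[OF elim, of _ "\<lambda>t. T + t"]) (use T in \<open>auto intro!: continuous_intros\<close>)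
    qed
    show "(\<integral>\<^sup>+\<omega>. ennreal ((W (T + v) \<omega> - W (T + u) \<omega>) ^ 4) \<partial>M) \<le> ennreal (3 * (v - u)\<^sup>2)"
      if "0 \<le> u" "u < v" for u v
      using W_moment4[of "T + u" "T + v"] T that by simp
  qed (use T in \<open>auto intro: measurable_W\<close>)
  then obtain V1 where V1: "V1 \<in> borel_measurable M" "(\<integral>\<^sup>+\<omega>. V1 \<omega> \<partial>M) \<le> ennreal (10 ^ 5 / b)"
    "AE \<omega> in M. \<forall>u\<ge>0. ennreal \<bar>W (T + u) \<omega> - W T \<omega>\<bar> \<le> ennreal (b * u) + V1 \<omega>" by auto
  have "\<exists>V\<in>borel_measurable M. (\<integral>\<^sup>+\<omega>. V \<omega> \<partial>M) \<le> ennreal (10 ^ 5 / b) \<and>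
      (AE \<omega> in M. \<forall>u\<ge>0. ennreal \<bar>W (max 0 (T - u)) \<omega> - W (max 0 (T - 0)) \<omega>\<bar> \<le> ennreal (b * u) + V \<omega>)"
  proof (rule drift_domination[where f="\<lambda>u. W (max 0 (T - u))", OF _ _ _ b])
    show "AE \<omega> in M. continuous_on {0..} (\<lambda>t. W (max 0 (T - t)) \<omega>)"
      using W_cont
    proof eventually_elim
      case (elim \<omega>)
      show ?case
        by (rule continuous_on_compose2[OF elim, of _ "\<lambda>t. max 0 (T - t)"]) (use T in \<open>auto intro!: continuous_intros\<close>)
    qed
    show "(\<integral>\<^sup>+\<omega>. ennreal ((W (max 0 (T - v)) \<omega> - W (max 0 (T - u)) \<omega>) ^ 4) \<partial>M) \<le> ennreal (3 * (v - u)\<^sup>2)"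
      if "0 \<le> u" "u < v" for u v
    proof -
      have "\<bar>max 0 (T - v) - max 0 (T - u)\<bar> \<le> \<bar>v - u\<bar>" using that by (simp add: max_def)
      then have "(max 0 (T - v) - max 0 (T - u))\<^sup>2 \<le> (v - u)\<^sup>2" by (simp add: abs_le_square_iff)
      then show ?thesis
        by (intro order_trans[OF W_moment4] ennreal_leI) auto
    qed
  qed (auto intro: measurable_W)
  then obtain V2 where V2: "V2 \<in> borel_measurable M" "(\<integral>\<^sup>+\<omega>. V2 \<omega> \<partial>M) \<le> ennreal (10 ^ 5 / b)"
    "AE \<omega> in M. \<forall>u\<ge>0. ennreal \<bar>W (max 0 (T - u)) \<omega> - W T \<omega>\<bar> \<le> ennreal (b * u) + V2 \<omega>"
    using T by auto
  have "(\<integral>\<^sup>+\<omega>. V1 \<omega> + V2 \<omega> \<partial>M) \<le> ennreal (10 ^ 5 / b) + ennreal (10 ^ 5 / b)"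
    using V1 V2 by (subst nn_integral_add) (auto intro: add_mono)
  also have "\<dots> = ennreal (2 * 10 ^ 5 / b)"
    using b by (subst ennreal_plus[symmetric]) auto
  finally have "(\<integral>\<^sup>+\<omega>. V1 \<omega> + V2 \<omega> \<partial>M) \<le> ennreal (2 * 10 ^ 5 / b)" .
  moreover have "AE \<omega> in M. \<forall>t\<ge>0. ennreal \<bar>W t \<omega> - W T \<omega>\<bar> \<le> ennreal (b * \<bar>t - T\<bar>) + (V1 \<omega> + V2 \<omega>)"
    using V1(3) V2(3)
  proof eventually_elim
    case (elim \<omega>)
    show ?case
    proof (intro allI impI)
      fix t :: real assume t: "0 \<le> t"
      show "ennreal \<bar>W t \<omega> - W T \<omega>\<bar> \<le> ennreal (b * \<bar>t - T\<bar>) + (V1 \<omega> + V2 \<omega>)"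
      proof (cases "T \<le> t")
        case True
        then have "ennreal \<bar>W t \<omega> - W T \<omega>\<bar> \<le> ennreal (b * \<bar>t - T\<bar>) + V1 \<omega>"
          using elim(1)[rule_format, of "t - T"] by simp
        then show ?thesis by (rule order_trans) (simp add: add_left_mono add_increasing2)
      next
        case False
        then have "ennreal \<bar>W t \<omega> - W T \<omega>\<bar> \<le> ennreal (b * \<bar>t - T\<bar>) + V2 \<omega>"
          using elim(2)[rule_format, of "T - t"] t by (simp add: max_def)
        then show ?thesis by (rule order_trans) (simp add: add_left_mono add_increasing)
      qed
    qed
  qed
  ultimately show ?thesis using V1(1) V2(1) by (intro bexI[of _ "\<lambda>\<omega>. V1 \<omega> + V2 \<omega>"]) auto
qed

end

section \<open>Linearization of hitting times\<close>

text \<open>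
  The level is hit at a time \<open>h\<close> with \<open>s * (h - T) = - x h\<close>. Dominating \<open>x h - x T\<close>
  by \<open>b * \<bar>h - T\<bar> + v\<close> with \<open>b \<le> s / 2\<close> first bounds \<open>\<bar>h - T\<bar>\<close>, and then the error of the
  linearization \<open>T - x T / s\<close> of \<open>h\<close>.
\<close>

lemma hitting_time_linearization:
  fixes x :: "real \<Rightarrow> real" and l s :: real
  defines "T \<equiv> l / s"
  assumes cont: "continuous_on {0..} x" and x0: "x 0 = 0" and s: "0 < s" and l: "0 < l"
    and b: "0 < b" "b \<le> s / 2" and v: "0 \<le> v"
    and dom: "\<And>t. 0 \<le> t \<Longrightarrow> \<bar>x t - x T\<bar> \<le> b * \<bar>t - T\<bar> + v"
  shows "\<exists>h. Inf (ereal ` {t. 0 \<le> t \<and> l \<le> x t + s * t}) = ereal h \<and>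
    \<bar>h - (T - x T / s)\<bar> \<le> 2 * b / s\<^sup>2 * \<bar>x T\<bar> + 2 * v / s"
proof -
  define S where "S = {t. 0 \<le> t \<and> l \<le> x t + s * t}"
  have sT: "s * T = l" and T: "0 < T" using s l by (auto simp: T_def)
  have cont': "continuous_on {0..} (\<lambda>t. x t + s * t)" by (intro continuous_intros cont)
  have "closed ({0..} \<inter> (\<lambda>t. x t + s * t) -` {l..})"
    by (intro continuous_closed_preimage cont') auto
  moreover have "{0..} \<inter> (\<lambda>t. x t + s * t) -` {l..} = S" by (auto simp: S_def)
  ultimately have "closed S" by simp
  have bdd: "bdd_below S" by (auto simp: S_def bdd_below_def)
  have ne: "S \<noteq> {}"
  proof -
    \<comment> \<open>By time \<open>T + d\<close> the level has been reached: the drift has gained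
      \<open>s * d\<close> beyond \<open>l\<close>, and \<open>x (T + d)\<close> is at least
      \<open>- (\<bar>x T\<bar> + b * d + v)\<close>, where \<open>b * d\<close> uses up at most
      half of that gain.\<close>
    define d where "d = 2 * (\<bar>x T\<bar> + v) / s"
    have d: "0 \<le> d" and sd: "s * d = 2 * (\<bar>x T\<bar> + v)" using s v by (auto simp: d_def)
    have "b * d \<le> (s / 2) * d" using b d by (intro mult_right_mono)
    then have "b * d \<le> \<bar>x T\<bar> + v" using sd by simp
    moreover have "\<bar>x (T + d) - x T\<bar> \<le> b * d + v" using dom[of "T + d"] d T by simp
    ultimately have "l \<le> x (T + d) + s * (T + d)"
      using sT sd by (simp add: distrib_left)
    then show ?thesis using d T by (auto simp: S_def intro!: exI[of _ "T + d"])
  qed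
  define h where "h = Inf S"
  have "h \<in> S" unfolding h_def by (rule closed_contains_Inf[OF ne bdd \<open>closed S\<close>])
  then have h: "0 \<le> h" "l \<le> x h + s * h" by (auto simp: S_def)
  have least: "h \<le> t" if "t \<in> S" for t unfolding h_def by (rule cInf_lower[OF that bdd])
  have Inf: "Inf (ereal ` S) = ereal h"
    by (rule antisym) (auto intro!: INF_lower INF_greatest \<open>h \<in> S\<close> least)
  have "x h + s * h = l"
  proof (rule ccontr)
    assume "x h + s * h \<noteq> l"
    then have "l < x h + s * h" using h by simp
    \<comment> \<open>Starting from \<open>0 < l\<close>, a path above the level at time
      \<open>h\<close> has already met it before, which contradicts the minimality of
      \<open>h\<close>.\<close>
    then obtain y where y: "0 \<le> y" "y \<le> h" "x y + s * y = l"
      using IVT'[of "\<lambda>t. x t + s * t" 0 l h] h l x0 continuous_on_subset[OF cont', of "{0..h}"] by auto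
    then have "h \<le> y" by (intro least) (auto simp: S_def)
    with y \<open>l < x h + s * h\<close> show False by simp
  qed
  then have xh: "x h = - (s * (h - T))" using sT by (simp add: right_diff_distrib)
  define d where "d = \<bar>h - T\<bar>"
  have dh: "\<bar>x h - x T\<bar> \<le> b * d + v" using dom[OF h(1)] by (simp add: d_def)
  have "s * d = \<bar>x h\<bar>" using s by (simp add: xh d_def abs_mult)
  also have "\<dots> \<le> \<bar>x T\<bar> + (b * d + v)" using dh by linarith
  \<comment> \<open>Since \<open>b \<le> s / 2\<close>, the term in \<open>d\<close> can be absorbed
    on the left.\<close>
  also have "\<dots> \<le> \<bar>x T\<bar> + (s / 2 * d + v)"
    using b by (intro add_left_mono add_right_mono mult_right_mono) (auto simp: d_def)
  finally have "s * d \<le> 2 * (\<bar>x T\<bar> + v)" by simp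
  then have d: "d \<le> 2 * (\<bar>x T\<bar> + v) / s" using s by (simp add: field_simps)
  have "h - (T - x T / s) = (x T - x h) / s"
    using s by (simp add: xh field_simps)
  then have "\<bar>h - (T - x T / s)\<bar> = \<bar>x h - x T\<bar> / s"
    using s by (simp add: abs_minus_commute)
  also have "\<dots> \<le> (b * (2 * (\<bar>x T\<bar> + v) / s) + v) / s"
    using s b dh d by (intro divide_right_mono order_trans[OF dh] add_right_mono mult_left_mono) auto
  also have "\<dots> = 2 * b / s\<^sup>2 * \<bar>x T\<bar> + (2 * b / s + 1) * v / s"
    using s by (simp add: field_simps power2_eq_square)
  also have "\<dots> \<le> 2 * b / s\<^sup>2 * \<bar>x T\<bar> + 2 * v / s"
    using s b v by (intro add_left_mono divide_right_mono mult_right_mono) (auto simp: field_simps)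
  finally show ?thesis using Inf unfolding S_def by blast
qed

text \<open>Here \<open>e\<close> stands for an error that involves a hitting time, about which no
  measurability is established, so the integral of \<open>e + r\<close> cannot simply be split.
  Instead the measurable function \<open>f - r\<close> is integrated; it lies below \<open>e\<close>
  wherever \<open>r\<close> is finite.\<close>

lemma le_nn_integral_add:
  assumes [measurable]: "f \<in> borel_measurable M" "r \<in> borel_measurable M"
    and le: "AE \<omega> in M. f \<omega> \<le> e \<omega> + r \<omega>"
  shows "(\<integral>\<^sup>+\<omega>. f \<omega> \<partial>M) \<le> (\<integral>\<^sup>+\<omega>. e \<omega> \<partial>M) + (\<integral>\<^sup>+\<omega>. r \<omega> \<partial>M)"
proof (cases "(\<integral>\<^sup>+\<omega>. r \<omega> \<partial>M) = \<infinity>")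
  case False
  then have fin: "AE \<omega> in M. r \<omega> \<noteq> \<infinity>" by (intro nn_integral_PInf_AE) auto
  have "(\<integral>\<^sup>+\<omega>. f \<omega> \<partial>M) \<le> (\<integral>\<^sup>+\<omega>. (f \<omega> - r \<omega>) + r \<omega> \<partial>M)"
    by (intro nn_integral_mono) (metis diff_add_self_ennreal linear order_refl)
  also have "\<dots> = (\<integral>\<^sup>+\<omega>. f \<omega> - r \<omega> \<partial>M) + (\<integral>\<^sup>+\<omega>. r \<omega> \<partial>M)"
    by (rule nn_integral_add) measurable
  also have "(\<integral>\<^sup>+\<omega>. f \<omega> - r \<omega> \<partial>M) \<le> (\<integral>\<^sup>+\<omega>. e \<omega> \<partial>M)"
    using le fin by (intro nn_integral_mono_AE) (auto simp: ennreal_minus_le_iff add.commute)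
  finally show ?thesis by (simp add: add_mono)
qed simp

section \<open>Errors of estimates with values in the extended reals\<close>

lemma e2ennreal_abs_diff_ereal: "e2ennreal \<bar>ereal a - ereal b\<bar> = ennreal \<bar>a - b\<bar>"
  by (simp add: ennreal.abs_eq[symmetric])

lemma e2ennreal_abs_triangle:
  fixes x :: ereal
  shows "e2ennreal \<bar>x - ereal a\<bar> \<le> e2ennreal \<bar>x - ereal b\<bar> + ennreal \<bar>b - a\<bar>"
  by (cases x) (auto simp: e2ennreal_abs_diff_ereal simp flip: ennreal_plus intro!: ennreal_leI)

section \<open>Reflection of a pair of independent Wiener processes\<close>

text \<open>The substitution is orthogonal, and \<open>d \<noteq> 0\<close> makes the old coordinate
  \<open>u\<close> together with the new coordinate \<open>x\<close> a coordinate system of the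
  plane. Rewriting either side in \<open>u\<close> and \<open>x\<close> produces the same factor
  \<open>\<bar>d\<bar>\<close>, so two one-dimensional substitutions and Fubini suffice.\<close>

lemma nn_integral_reflection:
  fixes h :: "real \<times> real \<Rightarrow> ennreal"
  assumes [measurable]: "h \<in> borel_measurable (borel \<Otimes>\<^sub>M borel)"
    and cd: "c\<^sup>2 + d\<^sup>2 = 1" "d \<noteq> 0"
  shows "(\<integral>\<^sup>+u. \<integral>\<^sup>+v. h (c * u + d * v, d * u - c * v) \<partial>lborel \<partial>lborel) = (\<integral>\<^sup>+x. \<integral>\<^sup>+y. h (x, y) \<partial>lborel \<partial>lborel)"
proof -
  have "(u - c * (c * u + d * v)) / d = d * u - c * v" for u v
  proof -
    have "u - c * (c * u + d * v) = (1 - c\<^sup>2) * u - c * d * v" by (simp add: algebra_simps power2_eq_square)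
    also have "\<dots> = d * (d * u - c * v)" using cd(1) by (simp add: algebra_simps power2_eq_square flip: cd(1))
    finally show ?thesis using cd(2) by simp
  qed
  then have 1: "(\<integral>\<^sup>+x. h (x, (u - c * x) / d) \<partial>lborel) = \<bar>d\<bar> * (\<integral>\<^sup>+v. h (c * u + d * v, d * u - c * v) \<partial>lborel)" for u
    using cd(2) by (subst nn_integral_real_affine[where c=d and t="c * u"]) auto
  have 2: "(\<integral>\<^sup>+u. h (x, (u - c * x) / d) \<partial>lborel) = \<bar>d\<bar> * (\<integral>\<^sup>+y. h (x, y) \<partial>lborel)" for x
    using cd(2) by (subst nn_integral_real_affine[where c=d and t="c * x"]) auto
  have "\<bar>d\<bar> * (\<integral>\<^sup>+u. \<integral>\<^sup>+v. h (c * u + d * v, d * u - c * v) \<partial>lborel \<partial>lborel)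
      = (\<integral>\<^sup>+u. \<integral>\<^sup>+x. h (x, (u - c * x) / d) \<partial>lborel \<partial>lborel)"
    unfolding 1 by (rule nn_integral_cmult[symmetric]) measurable
  also have "\<dots> = (\<integral>\<^sup>+x. \<integral>\<^sup>+u. h (x, (u - c * x) / d) \<partial>lborel \<partial>lborel)"
    by (rule lborel_pair.Fubini') measurable
  also have "\<dots> = \<bar>d\<bar> * (\<integral>\<^sup>+x. \<integral>\<^sup>+y. h (x, y) \<partial>lborel \<partial>lborel)"
    unfolding 2 by (rule nn_integral_cmult) measurable
  finally show ?thesis
    using cd(2) by (simp add: ennreal_mult_cancel_left)
qed

text \<open>With equal variances the joint density depends on \<open>u\<^sup>2 + v\<^sup>2\<close>
  only, which the orthogonal map preserves, just as it preserves Lebesgue measure.\<close>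

lemma (in prob_space) normal_pair_reflection:
  assumes U: "distributed M lborel U (normal_density 0 \<sigma>)" and V: "distributed M lborel V (normal_density 0 \<sigma>)"
    and ind: "indep_var borel U borel V" and cd: "c\<^sup>2 + d\<^sup>2 = 1" "d \<noteq> 0"
  shows "distr M (borel \<Otimes>\<^sub>M borel) (\<lambda>\<omega>. (c * U \<omega> + d * V \<omega>, d * U \<omega> - c * V \<omega>))
    = distr M (borel \<Otimes>\<^sub>M borel) (\<lambda>\<omega>. (U \<omega>, V \<omega>))"
proof (rule measure_eqI)
  have [measurable]: "U \<in> borel_measurable M" "V \<in> borel_measurable M"
    using U V by (auto simp: distributed_def)
  define g where "g p = ennreal (normal_density 0 \<sigma> (fst p)) * ennreal (normal_density 0 \<sigma> (snd p))" for p
  have [measurable]: "g \<in> borel_measurable (borel \<Otimes>\<^sub>M borel)" unfolding g_def by measurable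
  have g_refl: "g (c * u + d * v, d * u - c * v) = g (u, v)" for u v
  proof -
    have dens: "normal_density 0 \<sigma> x * normal_density 0 \<sigma> y = exp (- (x\<^sup>2 + y\<^sup>2) / (2 * \<sigma>\<^sup>2)) / (2 * pi * \<sigma>\<^sup>2)" for x y
      by (simp add: normal_density_def exp_add[symmetric] add_divide_distrib diff_divide_distrib)
    have "(c * u + d * v)\<^sup>2 + (d * u - c * v)\<^sup>2 = (c\<^sup>2 + d\<^sup>2) * (u\<^sup>2 + v\<^sup>2)"
      by (simp add: power2_eq_square algebra_simps)
    then have "(c * u + d * v)\<^sup>2 + (d * u - c * v)\<^sup>2 = u\<^sup>2 + v\<^sup>2" using cd by simp
    then show ?thesis by (simp add: g_def ennreal_mult[symmetric] dens del: minus_add_distrib)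
  qed
  have joint: "distributed M (lborel \<Otimes>\<^sub>M lborel) (\<lambda>\<omega>. (U \<omega>, V \<omega>)) (\<lambda>(x, y). ennreal (normal_density 0 \<sigma> x) * ennreal (normal_density 0 \<sigma> y))"
    using indep_var_compose[OF ind, of id lborel id lborel]
    by (intro distributed_joint_indep U V lborel.sigma_finite_measure_axioms) simp
  have *: "(\<integral>\<^sup>+\<omega>. k (U \<omega>, V \<omega>) \<partial>M) = (\<integral>\<^sup>+u. \<integral>\<^sup>+v. g (u, v) * k (u, v) \<partial>lborel \<partial>lborel)"
    if [measurable]: "k \<in> borel_measurable (borel \<Otimes>\<^sub>M borel)" for k
  proof -
    have "(\<integral>\<^sup>+\<omega>. k (U \<omega>, V \<omega>) \<partial>M) = (\<integral>\<^sup>+p. g p * k p \<partial>(lborel \<Otimes>\<^sub>M lborel))"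
      using distributed_nn_integral[OF joint, of k] by (simp add: g_def case_prod_beta')
    then show ?thesis by (subst lborel.nn_integral_fst) auto
  qed
  fix A assume "A \<in> sets (distr M (borel \<Otimes>\<^sub>M borel) (\<lambda>\<omega>. (c * U \<omega> + d * V \<omega>, d * U \<omega> - c * V \<omega>)))"
  then have A[measurable]: "A \<in> sets (borel \<Otimes>\<^sub>M borel)" by simp
  have "emeasure (distr M (borel \<Otimes>\<^sub>M borel) (\<lambda>\<omega>. (c * U \<omega> + d * V \<omega>, d * U \<omega> - c * V \<omega>))) A
      = (\<integral>\<^sup>+\<omega>. indicator A (c * U \<omega> + d * V \<omega>, d * U \<omega> - c * V \<omega>) \<partial>M)"
    by (simp add: nn_integral_distr flip: nn_integral_indicator)
  also have "\<dots> = (\<integral>\<^sup>+u. \<integral>\<^sup>+v. g (u, v) * indicator A (c * u + d * v, d * u - c * v) \<partial>lborel \<partial>lborel)"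
    using *[of "\<lambda>p. indicator A (c * fst p + d * snd p, d * fst p - c * snd p)"] by simp
  also have "\<dots> = (\<integral>\<^sup>+u. \<integral>\<^sup>+v. g (u, v) * indicator A (u, v) \<partial>lborel \<partial>lborel)"
    using nn_integral_reflection[of "\<lambda>p. g p * indicator A p", OF _ cd] by (simp add: g_refl)
  also have "\<dots> = (\<integral>\<^sup>+\<omega>. indicator A (U \<omega>, V \<omega>) \<partial>M)"
    using *[of "indicator A"] by simp
  also have "\<dots> = emeasure (distr M (borel \<Otimes>\<^sub>M borel) (\<lambda>\<omega>. (U \<omega>, V \<omega>))) A"
    by (simp add: nn_integral_distr flip: nn_integral_indicator)
  finally show "emeasure (distr M (borel \<Otimes>\<^sub>M borel) (\<lambda>\<omega>. (c * U \<omega> + d * V \<omega>, d * U \<omega> - c * V \<omega>))) A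
      = emeasure (distr M (borel \<Otimes>\<^sub>M borel) (\<lambda>\<omega>. (U \<omega>, V \<omega>))) A" .
qed simp

text \<open>Arranges finitely many times as a grid of the kind that independence of increments
  speaks of. Starting at \<open>0\<close> lets values be recovered as sums of increments, and the
  second point \<open>T\<close> guarantees at least one increment.\<close>

lemma increasing_enumeration:
  fixes F :: "real set"
  assumes "finite F" "0 \<in> F" "T \<in> F" "0 < T" "\<And>x. x \<in> F \<Longrightarrow> 0 \<le> x"
  obtains t :: "nat \<Rightarrow> real" and n
  where "t 0 = 0" "0 < n" "\<And>i. i < n \<Longrightarrow> t i < t (Suc i)" "F = t ` {..n}"
proof -
  define xs where "xs = sorted_list_of_set F"
  define n where "n = length xs - 1"
  define t where "t i = xs ! i" for i
  have set: "set xs = F" using assms by (simp add: xs_def)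
  have ne: "xs \<noteq> []" using set assms by auto
  have sorted: "sorted_wrt (<) xs" by (simp add: xs_def)
  have len: "length xs = Suc n" using ne by (simp add: n_def)
  have inc: "t i < t (Suc i)" if "i < n" for i
    using sorted that len unfolding t_def by (simp add: sorted_wrt_nth_less)
  have F: "F = t ` {..n}"
    unfolding set[symmetric] set_conv_nth t_def len by (auto simp: less_Suc_eq_le)
  have t0: "t 0 = 0"
  proof -
    obtain k where k: "k \<le> n" "t k = 0" using assms(2) F by auto
    have "t 0 \<le> t k" using strict_sorted_imp_sorted[OF sorted] len k unfolding t_def by (intro sorted_nth_mono) auto
    moreover have "0 \<le> t 0" using assms(5) F by auto
    ultimately show ?thesis using k by simp
  qed
  have "n \<noteq> 0"
  proof
    assume "n = 0"
    then show False using F t0 assms(3,4) by auto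
  qed
  then show ?thesis using that[of t n] t0 inc F by simp
qed

text \<open>Independence within \<open>X\<close>, within \<open>Y\<close>, and between the two
  families makes all \<open>2 * n\<close> variables jointly independent. They are collected into one
  family \<open>Z\<close> indexed by a Boolean and a number, and then regrouped.\<close>

lemma (in prob_space) indep_vars_pairI:
  fixes X Y :: "nat \<Rightarrow> 'a \<Rightarrow> real"
  assumes X: "indep_vars (\<lambda>_. borel) X {..<n}" and Y: "indep_vars (\<lambda>_. borel) Y {..<n}"
    and prod: "\<And>A C. (\<And>i. i < n \<Longrightarrow> A i \<in> sets borel) \<Longrightarrow> (\<And>i. i < n \<Longrightarrow> C i \<in> sets borel) \<Longrightarrow>
      prob ({\<omega>\<in>space M. \<forall>i<n. X i \<omega> \<in> A i} \<inter> {\<omega>\<in>space M. \<forall>i<n. Y i \<omega> \<in> C i})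
      = prob {\<omega>\<in>space M. \<forall>i<n. X i \<omega> \<in> A i} * prob {\<omega>\<in>space M. \<forall>i<n. Y i \<omega> \<in> C i}"
    and n: "0 < n"
  shows "indep_vars (\<lambda>_. borel \<Otimes>\<^sub>M borel) (\<lambda>i \<omega>. (X i \<omega>, Y i \<omega>)) {..<n}"
proof -
  have rv: "X i \<in> borel_measurable M" "Y i \<in> borel_measurable M" if "i < n" for i
    using X Y that by (auto simp: indep_vars_def)
  define Z where "Z = (\<lambda>(b, i). if b then X i else Y i)"
  define I where "I = (UNIV :: bool set) \<times> {..<n}"
  have indX: "prob {\<omega>\<in>space M. \<forall>i<n. X i \<omega> \<in> A i} = (\<Prod>i<n. prob {\<omega>\<in>space M. X i \<omega> \<in> A i})"
    if "\<And>i. i < n \<Longrightarrow> A i \<in> sets borel" for A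
  proof -
    have "prob (\<Inter>i<n. X i -` A i \<inter> space M) = (\<Prod>i<n. prob (X i -` A i \<inter> space M))"
      by (rule indep_varsD[OF X]) (use n that in auto)
    moreover have "(\<Inter>i<n. X i -` A i \<inter> space M) = {\<omega>\<in>space M. \<forall>i<n. X i \<omega> \<in> A i}"
      using n by auto
    moreover have "X i -` A i \<inter> space M = {\<omega>\<in>space M. X i \<omega> \<in> A i}" for i by auto
    ultimately show ?thesis by simp
  qed
  have indY: "prob {\<omega>\<in>space M. \<forall>i<n. Y i \<omega> \<in> A i} = (\<Prod>i<n. prob {\<omega>\<in>space M. Y i \<omega> \<in> A i})"
    if "\<And>i. i < n \<Longrightarrow> A i \<in> sets borel" for A
  proof -
    have "prob (\<Inter>i<n. Y i -` A i \<inter> space M) = (\<Prod>i<n. prob (Y i -` A i \<inter> space M))"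
      by (rule indep_varsD[OF Y]) (use n that in auto)
    moreover have "(\<Inter>i<n. Y i -` A i \<inter> space M) = {\<omega>\<in>space M. \<forall>i<n. Y i \<omega> \<in> A i}"
      using n by auto
    moreover have "Y i -` A i \<inter> space M = {\<omega>\<in>space M. Y i \<omega> \<in> A i}" for i by auto
    ultimately show ?thesis by simp
  qed
  have "indep_vars (\<lambda>_. borel) Z I"
    unfolding indep_vars_def2
  proof (intro conjI ballI indep_setsI)
    fix i assume "i \<in> I"
    then show "Z i \<in> borel_measurable M" by (auto simp: I_def Z_def rv split: prod.splits)
  next
    fix i assume i: "i \<in> I"
    show "{Z i -` A \<inter> space M |A. A \<in> sets borel} \<subseteq> events"
    proof -
      have "Z i \<in> borel_measurable M" using i by (auto simp: I_def Z_def rv split: prod.splits)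
      then show ?thesis by (auto intro: measurable_sets)
    qed
  next
    fix A J assume J: "J \<noteq> {}" "J \<subseteq> I" "finite J" and A: "\<forall>j\<in>J. A j \<in> {Z j -` A \<inter> space M |A. A \<in> sets borel}"
    then have "\<forall>j\<in>J. \<exists>C. C \<in> sets borel \<and> A j = Z j -` C \<inter> space M" by blast
    from bchoice[OF this] obtain C
      where C: "\<And>j. j \<in> J \<Longrightarrow> C j \<in> sets borel" "\<And>j. j \<in> J \<Longrightarrow> A j = Z j -` C j \<inter> space M"
      by blast
    \<comment> \<open>Allowing every value outside \<open>J\<close> turns an event about
      \<open>J\<close> into one about all of \<open>I\<close>; the additional factors have
      probability one.\<close>
    define D where "D j = (if j \<in> J then C j else UNIV)" for j
    have D: "D j \<in> sets borel" for j using C by (simp add: D_def)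
    let ?P = "\<lambda>j. prob {\<omega>\<in>space M. Z j \<omega> \<in> D j}"
    have "(\<Inter>j\<in>J. A j) = {\<omega>\<in>space M. \<forall>i<n. X i \<omega> \<in> D (True, i)} \<inter> {\<omega>\<in>space M. \<forall>i<n. Y i \<omega> \<in> D (False, i)}"
    proof -
      have "\<omega> \<in> (\<Inter>j\<in>J. A j) \<longleftrightarrow> \<omega> \<in> space M \<and> (\<forall>j\<in>I. Z j \<omega> \<in> D j)" for \<omega>
        using J C(2) by (auto simp: D_def split: if_splits)
      then show ?thesis by (auto simp: I_def Z_def set_eq_iff)
    qed
    then have "prob (\<Inter>j\<in>J. A j) = (\<Prod>i<n. ?P (True, i)) * (\<Prod>i<n. ?P (False, i))"
      by (simp add: prod D indX indY Z_def)
    also have "\<dots> = (\<Prod>j\<in>I. ?P j)"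
      by (simp add: I_def prod.cartesian_product' UNIV_bool mult.commute)
    also have "\<dots> = (\<Prod>j\<in>J. ?P j)"
      using J by (intro prod.mono_neutral_right) (auto simp: I_def D_def prob_space)
    also have "\<dots> = (\<Prod>j\<in>J. prob (A j))"
      by (intro prod.cong refl arg_cong[where f=prob]) (auto simp: C D_def)
    finally show "prob (\<Inter>j\<in>J. A j) = (\<Prod>j\<in>J. prob (A j))" .
  qed
  \<comment> \<open>The columns, one for each \<open>i\<close>, are disjoint groups of indices and
    hence give independent groups; each pair is a function of its column.\<close>
  then have "indep_vars (\<lambda>i. PiM (UNIV \<times> {i}) (\<lambda>_. borel)) (\<lambda>i \<omega>. restrict (\<lambda>j. Z j \<omega>) (UNIV \<times> {i})) {..<n}"
    by (rule indep_vars_restrict) (auto simp: I_def disjoint_family_on_def)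
  then have "indep_vars (\<lambda>_. borel \<Otimes>\<^sub>M borel)
      (\<lambda>i \<omega>. (\<lambda>p. (p (True, i), p (False, i))) (restrict (\<lambda>j. Z j \<omega>) (UNIV \<times> {i}))) {..<n}"
    by (rule indep_vars_compose2) auto
  then show ?thesis by (simp add: Z_def)
qed

section \<open>Two independent Wiener processes and their reflection\<close>

locale wiener_pair = B: wiener M B + N: wiener M N
  for M :: "'a measure" and B N :: "real \<Rightarrow> 'a \<Rightarrow> real" +
  assumes indep: "indep_processes M B N"
begin

lemma measurable_path: "path B \<in> measurable M path_space" "path N \<in> measurable M path_space"
  unfolding path_space_def path_def
  by (auto intro!: measurable_restrict B.measurable_W N.measurable_W)

lemma indep_paths: "B.indep_var path_space (path B) path_space (path N)"
  using indep by (simp add: indep_processes_def)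

lemma indep_compose:
  assumes "f \<in> measurable path_space borel" "g \<in> measurable path_space borel"
  shows "B.indep_var borel (\<lambda>\<omega>. f (path B \<omega>)) borel (\<lambda>\<omega>. g (path N \<omega>))"
  using B.indep_var_compose[OF indep_paths assms] by (simp add: comp_def)

lemma measurable_path_component [measurable]: "0 \<le> t \<Longrightarrow> (\<lambda>y. y t) \<in> borel_measurable path_space"
  unfolding path_space_def by (rule measurable_component_singleton) simp

text \<open>The product rule demanded by \<open>indep_vars_pairI\<close> comes from the independence
  of the whole paths, because events about increments are preimages of the measurable sets
  \<open>S A\<close> of \<open>path_space\<close>.\<close>

lemma indep_increment_pairs:
  assumes t: "0 \<le> t 0" "\<And>i. i < n \<Longrightarrow> t i < t (Suc i)" and n: "0 < n"
  shows "B.indep_vars (\<lambda>_. borel \<Otimes>\<^sub>M borel)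
    (\<lambda>i \<omega>. (B (t (Suc i)) \<omega> - B (t i) \<omega>, N (t (Suc i)) \<omega> - N (t i) \<omega>)) {..<n}"
proof (rule B.indep_vars_pairI[OF B.W_indep N.W_indep _ n])
  have t_nonneg: "0 \<le> t i" if "i \<le> n" for i
    using that
  proof (induction i)
    case (Suc i)
    then show ?case using t(2)[of i] by simp
  qed (use t in simp)
  fix A C :: "nat \<Rightarrow> real set"
  assume A: "\<And>i. i < n \<Longrightarrow> A i \<in> sets borel" and C: "\<And>i. i < n \<Longrightarrow> C i \<in> sets borel"
  define S where "S A = {y\<in>space path_space. \<forall>i\<in>{..<n}. y (t (Suc i)) - y (t i) \<in> A i}" for A :: "nat \<Rightarrow> real set"
  have S: "S A \<in> sets path_space" if A: "\<And>i. i < n \<Longrightarrow> A i \<in> sets borel" for A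
    unfolding S_def
  proof (rule sets.sets_Collect_finite_All')
    fix i assume "i \<in> {..<n}"
    then have "i < n" by simp
    have [measurable]: "A i \<in> sets borel" using A \<open>i < n\<close> by simp
    have [measurable]: "(\<lambda>y. y (t (Suc i))) \<in> borel_measurable path_space" "(\<lambda>y. y (t i)) \<in> borel_measurable path_space"
      using t_nonneg \<open>i < n\<close> by (auto intro!: measurable_path_component)
    show "{y\<in>space path_space. y (t (Suc i)) - y (t i) \<in> A i} \<in> sets path_space" by measurable
  qed (use n in auto)
  have eq: "path W -` S A \<inter> space M = {\<omega>\<in>space M. \<forall>i<n. W (t (Suc i)) \<omega> - W (t i) \<omega> \<in> A i}"
    if "path W \<in> measurable M path_space" for W A
    using measurable_space[OF that] t_nonneg by (auto simp: S_def path_def)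
  have "B.prob ((\<lambda>\<omega>. (path B \<omega>, path N \<omega>)) -` (S A \<times> S C) \<inter> space M)
      = B.prob (path B -` S A \<inter> space M) * B.prob (path N -` S C \<inter> space M)"
    by (rule B.indep_varD[OF indep_paths]) (use S A C in auto)
  moreover have "(\<lambda>\<omega>. (path B \<omega>, path N \<omega>)) -` (S A \<times> S C) \<inter> space M
      = (path B -` S A \<inter> space M) \<inter> (path N -` S C \<inter> space M)" by auto
  ultimately show "B.prob ({\<omega>\<in>space M. \<forall>i<n. B (t (Suc i)) \<omega> - B (t i) \<omega> \<in> A i} \<inter>
        {\<omega>\<in>space M. \<forall>i<n. N (t (Suc i)) \<omega> - N (t i) \<omega> \<in> C i})
      = B.prob {\<omega>\<in>space M. \<forall>i<n. B (t (Suc i)) \<omega> - B (t i) \<omega> \<in> A i} *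
        B.prob {\<omega>\<in>space M. \<forall>i<n. N (t (Suc i)) \<omega> - N (t i) \<omega> \<in> C i}"
    by (simp add: eq measurable_path)
qed (use t in auto)

text \<open>For \<epsilon> = tan \<theta> the coefficients are cos 2\<theta> and sin 2\<theta>.
  Together with \<open>reflected_N\<close> this is the reflection of the plane that fixes the
  direction \<open>(1, \<epsilon>)\<close> and negates the orthogonal one.\<close>

definition reflected_B :: "real \<Rightarrow> real \<Rightarrow> 'a \<Rightarrow> real" where
  "reflected_B \<epsilon> t \<omega> = (1 - \<epsilon>\<^sup>2) / (1 + \<epsilon>\<^sup>2) * B t \<omega> + 2 * \<epsilon> / (1 + \<epsilon>\<^sup>2) * N t \<omega>"

definition reflected_N :: "real \<Rightarrow> real \<Rightarrow> 'a \<Rightarrow> real" where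
  "reflected_N \<epsilon> t \<omega> = 2 * \<epsilon> / (1 + \<epsilon>\<^sup>2) * B t \<omega> - (1 - \<epsilon>\<^sup>2) / (1 + \<epsilon>\<^sup>2) * N t \<omega>"

lemma measurable_reflected:
  assumes "0 \<le> t"
  shows "reflected_B \<epsilon> t \<in> borel_measurable M" "reflected_N \<epsilon> t \<in> borel_measurable M"
  using B.measurable_W[OF assms] N.measurable_W[OF assms]
  unfolding reflected_B_def[abs_def] reflected_N_def[abs_def] by auto

text \<open>The observed noise is the inner product with the vector \<open>(1, \<epsilon>)\<close>,
  which the symmetric reflection matrix fixes.\<close>

lemma reflected_observation: "reflected_B \<epsilon> t \<omega> + \<epsilon> * reflected_N \<epsilon> t \<omega> = B t \<omega> + \<epsilon> * N t \<omega>"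
proof -
  have p: "1 + \<epsilon>\<^sup>2 > 0" by (simp add: add_pos_nonneg)
  have "(1 - \<epsilon>\<^sup>2) + \<epsilon> * (2 * \<epsilon>) = 1 + \<epsilon>\<^sup>2" by (simp add: power2_eq_square)
  then have "((1 - \<epsilon>\<^sup>2) + \<epsilon> * (2 * \<epsilon>)) / (1 + \<epsilon>\<^sup>2) = 1" using p by simp
  then have "(1 - \<epsilon>\<^sup>2) / (1 + \<epsilon>\<^sup>2) + \<epsilon> * (2 * \<epsilon> / (1 + \<epsilon>\<^sup>2)) = 1"
    by (simp add: add_divide_distrib)
  moreover have "2 * \<epsilon> / (1 + \<epsilon>\<^sup>2) - \<epsilon> * ((1 - \<epsilon>\<^sup>2) / (1 + \<epsilon>\<^sup>2)) = \<epsilon>"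
  proof -
    have "2 * \<epsilon> - \<epsilon> * (1 - \<epsilon>\<^sup>2) = \<epsilon> * (1 + \<epsilon>\<^sup>2)" by (simp add: algebra_simps)
    then have "(2 * \<epsilon> - \<epsilon> * (1 - \<epsilon>\<^sup>2)) / (1 + \<epsilon>\<^sup>2) = \<epsilon>" using p by simp
    then show ?thesis by (subst times_divide_eq_right) (subst diff_divide_distrib[symmetric])
  qed
  moreover have "reflected_B \<epsilon> t \<omega> + \<epsilon> * reflected_N \<epsilon> t \<omega> =
     ((1 - \<epsilon>\<^sup>2) / (1 + \<epsilon>\<^sup>2) + \<epsilon> * (2 * \<epsilon> / (1 + \<epsilon>\<^sup>2))) * B t \<omega> + (2 * \<epsilon> / (1 + \<epsilon>\<^sup>2) - \<epsilon> * ((1 - \<epsilon>\<^sup>2) / (1 + \<epsilon>\<^sup>2))) * N t \<omega>"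
    by (simp add: reflected_B_def reflected_N_def algebra_simps)
  ultimately show ?thesis by simp
qed

text \<open>Each increment pair is mapped by the same reflection \<open>R\<close>. Pairs over
  different steps are independent before and after, so both laws are products, and their factors
  agree by \<open>normal_pair_reflection\<close>.\<close>

lemma increments_reflection:
  assumes \<epsilon>: "0 < \<epsilon>" and t: "0 \<le> t 0" "\<And>i. i < n \<Longrightarrow> t i < t (Suc i)" and n: "0 < n"
  shows "distr M (\<Pi>\<^sub>M i\<in>{..<n}. borel \<Otimes>\<^sub>M borel) (\<lambda>\<omega>. \<lambda>i\<in>{..<n}.
      (reflected_B \<epsilon> (t (Suc i)) \<omega> - reflected_B \<epsilon> (t i) \<omega>, reflected_N \<epsilon> (t (Suc i)) \<omega> - reflected_N \<epsilon> (t i) \<omega>))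
    = distr M (\<Pi>\<^sub>M i\<in>{..<n}. borel \<Otimes>\<^sub>M borel) (\<lambda>\<omega>. \<lambda>i\<in>{..<n}.
      (B (t (Suc i)) \<omega> - B (t i) \<omega>, N (t (Suc i)) \<omega> - N (t i) \<omega>))"
proof -
  define c where "c = (1 - \<epsilon>\<^sup>2) / (1 + \<epsilon>\<^sup>2)"
  define d where "d = 2 * \<epsilon> / (1 + \<epsilon>\<^sup>2)"
  have p: "1 + \<epsilon>\<^sup>2 > 0" by (simp add: add_pos_nonneg)
  have d: "d \<noteq> 0" using \<epsilon> p by (simp add: d_def)
  have "(1 - \<epsilon>\<^sup>2)\<^sup>2 + (2 * \<epsilon>)\<^sup>2 = (1 + \<epsilon>\<^sup>2)\<^sup>2" by (simp add: power2_eq_square algebra_simps)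
  then have cd: "c\<^sup>2 + d\<^sup>2 = 1"
    using p by (simp add: c_def d_def power_divide add_divide_distrib[symmetric])
  have t_nonneg: "0 \<le> t i" if "i \<le> n" for i
    using that
  proof (induction i)
    case (Suc i)
    then show ?case using t(2)[of i] by simp
  qed (use t in simp)
  define P where "P i \<omega> = (B (t (Suc i)) \<omega> - B (t i) \<omega>, N (t (Suc i)) \<omega> - N (t i) \<omega>)" for i \<omega>
  define R where "R = (\<lambda>(u, v). (c * u + d * v, d * u - c * v))"
  have R[measurable]: "R \<in> (borel \<Otimes>\<^sub>M borel) \<rightarrow>\<^sub>M (borel \<Otimes>\<^sub>M borel)" unfolding R_def by measurable
  have R_eq: "(reflected_B \<epsilon> (t (Suc i)) \<omega> - reflected_B \<epsilon> (t i) \<omega>, reflected_N \<epsilon> (t (Suc i)) \<omega> - reflected_N \<epsilon> (t i) \<omega>)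
      = R (P i \<omega>)" for i \<omega>
    unfolding reflected_B_def reflected_N_def c_def[symmetric] d_def[symmetric] by (simp add: R_def P_def algebra_simps)
  have indP: "B.indep_vars (\<lambda>_. borel \<Otimes>\<^sub>M borel) P {..<n}"
    using indep_increment_pairs[OF t n] by (simp add: P_def[abs_def])
  have indRP: "B.indep_vars (\<lambda>_. borel \<Otimes>\<^sub>M borel) (\<lambda>i \<omega>. R (P i \<omega>)) {..<n}"
    by (rule B.indep_vars_compose2[OF indP]) measurable
  have same: "distr M (borel \<Otimes>\<^sub>M borel) (\<lambda>\<omega>. R (P i \<omega>)) = distr M (borel \<Otimes>\<^sub>M borel) (P i)" if i: "i < n" for i
  proof -
    have ti: "0 \<le> t i" "0 \<le> t (Suc i)" "t i < t (Suc i)" using t_nonneg i t by auto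
    have "B.indep_var borel (\<lambda>\<omega>. (\<lambda>y. y (t (Suc i)) - y (t i)) (path B \<omega>)) borel (\<lambda>\<omega>. (\<lambda>y. y (t (Suc i)) - y (t i)) (path N \<omega>))"
      using ti by (intro indep_compose borel_measurable_diff measurable_path_component)
    then have "B.indep_var borel (\<lambda>\<omega>. B (t (Suc i)) \<omega> - B (t i) \<omega>) borel (\<lambda>\<omega>. N (t (Suc i)) \<omega> - N (t i) \<omega>)"
      using ti by (simp add: path_def)
    from B.normal_pair_reflection[OF B.W_increment N.W_increment this cd d] ti
    show ?thesis by (simp add: R_def P_def[abs_def])
  qed
  have ne: "{..<n} \<noteq> {}" using n by auto
  have "distr M (\<Pi>\<^sub>M i\<in>{..<n}. borel \<Otimes>\<^sub>M borel) (\<lambda>\<omega>. \<lambda>i\<in>{..<n}. R (P i \<omega>))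
      = (\<Pi>\<^sub>M i\<in>{..<n}. distr M (borel \<Otimes>\<^sub>M borel) (\<lambda>\<omega>. R (P i \<omega>)))"
    using indRP B.indep_vars_iff_distr_eq_PiM'[OF ne, of "\<lambda>i \<omega>. R (P i \<omega>)" "\<lambda>_. borel \<Otimes>\<^sub>M borel"]
    by (auto simp: B.indep_vars_def)
  also have "\<dots> = (\<Pi>\<^sub>M i\<in>{..<n}. distr M (borel \<Otimes>\<^sub>M borel) (P i))"
    by (intro PiM_cong) (auto simp: same)
  also have "\<dots> = distr M (\<Pi>\<^sub>M i\<in>{..<n}. borel \<Otimes>\<^sub>M borel) (\<lambda>\<omega>. \<lambda>i\<in>{..<n}. P i \<omega>)"
    using indP B.indep_vars_iff_distr_eq_PiM'[OF ne, of P "\<lambda>_. borel \<Otimes>\<^sub>M borel"]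
    by (auto simp: B.indep_vars_def)
  finally show ?thesis unfolding R_eq P_def .
qed

text \<open>
  The observation and the signal noise at time \<open>T\<close> become one process by letting the index \<open>- 1\<close>
  stand for the latter.
\<close>

definition joint_process :: "real \<Rightarrow> real \<Rightarrow> real \<Rightarrow> (real \<Rightarrow> 'a \<Rightarrow> real) \<Rightarrow> (real \<Rightarrow> 'a \<Rightarrow> real) \<Rightarrow> real \<Rightarrow> 'a \<Rightarrow> real" where
  "joint_process s \<epsilon> T b n j \<omega> = (if 0 \<le> j then b j \<omega> + s * j + \<epsilon> * n j \<omega> else b T \<omega>)"

lemma measurable_joint_process:
  assumes "0 \<le> T" "\<And>t. 0 \<le> t \<Longrightarrow> b t \<in> borel_measurable M" "\<And>t. 0 \<le> t \<Longrightarrow> n t \<in> borel_measurable M"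
  shows "(\<lambda>\<omega>. \<lambda>j\<in>I. joint_process s \<epsilon> T b n j \<omega>) \<in> measurable M (PiM I (\<lambda>_. borel))"
proof (rule measurable_restrict)
  fix j
  show "(\<lambda>\<omega>. joint_process s \<epsilon> T b n j \<omega>) \<in> borel_measurable M"
    using assms(2,3)[of j] assms(2)[OF assms(1)] unfolding joint_process_def by (cases "0 \<le> j") simp_all
qed

text \<open>A law on the product space is determined by cylinder events over finitely many indices.
  Such an event is a statement about the increments over a finite grid, whose law is unchanged by
  \<open>increments_reflection\<close>.\<close>

lemma joint_process_reflection:
  assumes \<epsilon>: "0 < \<epsilon>" and T: "0 < T"
  defines "I \<equiv> insert (- 1) {0..} :: real set"
  shows "distr M (PiM I (\<lambda>_. borel)) (\<lambda>\<omega>. \<lambda>j\<in>I. joint_process s \<epsilon> T (reflected_B \<epsilon>) (reflected_N \<epsilon>) j \<omega>)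
    = distr M (PiM I (\<lambda>_. borel)) (\<lambda>\<omega>. \<lambda>j\<in>I. joint_process s \<epsilon> T B N j \<omega>)"
    (is "distr M ?P ?U' = distr M ?P ?U")
proof (rule measure_eqI_PiM_infinite)
  have mU: "?U \<in> measurable M ?P" "?U' \<in> measurable M ?P"
    by (intro measurable_joint_process B.measurable_W N.measurable_W measurable_reflected less_imp_le[OF T]; assumption)+
  show "finite_measure (distr M ?P ?U')"
    using mU by (intro prob_space.finite_measure B.prob_space_distr)
  fix A :: "real \<Rightarrow> real set" and J
  assume J: "finite J" "J \<subseteq> I" and A: "\<And>i. i \<in> J \<Longrightarrow> A i \<in> sets borel"
  \<comment> \<open>The grid contains \<open>0\<close>, where both processes vanish, and
    \<open>T\<close>, the time that the index \<open>- 1\<close> stands for.\<close>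
  let ?F = "insert 0 (insert T (J - {-1}))"
  have fin: "finite ?F" "0 \<in> ?F" "T \<in> ?F" and nonneg: "\<And>x. x \<in> ?F \<Longrightarrow> 0 \<le> x"
    using J T by (auto simp: I_def)
  obtain t n where t: "t 0 = 0" "0 < n" "\<And>i. i < n \<Longrightarrow> t i < t (Suc i)" and F: "?F = t ` {..n}"
    by (rule increasing_enumeration[OF fin T]) (erule nonneg, rule that)
  have "\<forall>j\<in>?F. \<exists>k. k \<le> n \<and> t k = j" unfolding F by auto
  from bchoice[OF this] obtain k where "\<forall>j\<in>?F. k j \<le> n \<and> t (k j) = j" by blast
  then have k: "k j \<le> n \<and> t (k j) = j" if "j = T \<or> j \<in> J \<and> j \<noteq> -1" for j
    using that by auto
  define inc where "inc b m \<omega> = (\<lambda>i\<in>{..<n}. (b (t (Suc i)) \<omega> - b (t i) \<omega>, m (t (Suc i)) \<omega> - m (t i) \<omega>))"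
    for b m :: "real \<Rightarrow> 'a \<Rightarrow> real" and \<omega>
  \<comment> \<open>Reconstructs the process from its increments: \<open>k j\<close> is the position
    of \<open>j\<close> on the grid, and for the index \<open>- 1\<close> the sum stops at the
    position of \<open>T\<close>.\<close>
  define G where "G j p = (if 0 \<le> j
      then (\<Sum>i<k j. fst (p i)) + s * j + \<epsilon> * (\<Sum>i<k j. snd (p i)) else (\<Sum>i<k T. fst (p i)))"
    for j :: real and p :: "nat \<Rightarrow> real \<times> real"
  let ?Q = "\<Pi>\<^sub>M i\<in>{..<n}. (borel :: real measure) \<Otimes>\<^sub>M (borel :: real measure)"
  have [measurable]: "G j \<in> borel_measurable ?Q" if "j \<in> J" for j
  proof -
    have *: "(\<lambda>p. p i) \<in> measurable ?Q (borel \<Otimes>\<^sub>M borel)" if "i < n" for i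
      using that by (intro measurable_component_singleton) simp
    have "(\<lambda>p. \<Sum>i<m. fst (p i)) \<in> borel_measurable ?Q" "(\<lambda>p. \<Sum>i<m. snd (p i)) \<in> borel_measurable ?Q"
      if "m \<le> n" for m
      using that by (auto intro!: borel_measurable_sum measurable_compose[OF * measurable_fst] measurable_compose[OF * measurable_snd])
    moreover have "k T \<le> n" "0 \<le> j \<Longrightarrow> k j \<le> n" using k[of T] k[of j] that by auto
    ultimately show ?thesis unfolding G_def[abs_def] by (cases "0 \<le> j") simp_all
  qed
  have tele: "(\<Sum>i<m. fst (inc b c \<omega> i)) = b (t m) \<omega>" "(\<Sum>i<m. snd (inc b c \<omega> i)) = c (t m) \<omega>"
    if "m \<le> n" "b 0 \<omega> = 0" "c 0 \<omega> = 0" for m b c \<omega>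
  proof -
    have "(\<Sum>i<m. fst (inc b c \<omega> i)) = (\<Sum>i<m. b (t (Suc i)) \<omega> - b (t i) \<omega>)"
      "(\<Sum>i<m. snd (inc b c \<omega> i)) = (\<Sum>i<m. c (t (Suc i)) \<omega> - c (t i) \<omega>)"
      using that by (auto intro!: sum.cong simp: inc_def)
    then show "(\<Sum>i<m. fst (inc b c \<omega> i)) = b (t m) \<omega>" "(\<Sum>i<m. snd (inc b c \<omega> i)) = c (t m) \<omega>"
      by (simp_all add: sum_lessThan_telescope[of "\<lambda>i. b (t i) \<omega>"] sum_lessThan_telescope[of "\<lambda>i. c (t i) \<omega>"] t that)
  qed
  have G: "joint_process s \<epsilon> T b m j \<omega> = G j (inc b m \<omega>)" if "j \<in> J" "b 0 \<omega> = 0" "m 0 \<omega> = 0" for b m \<omega> j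
    using that J k[of j] k[of T] by (auto simp: joint_process_def G_def tele I_def)
  \<comment> \<open>Stated for arbitrary \<open>b\<close> and \<open>m\<close>, so that it serves
    the original and the reflected pair alike: the probability of a cylinder depends only on the law
    of the increments.\<close>
  have em: "emeasure (distr M ?P (\<lambda>\<omega>. \<lambda>j\<in>I. joint_process s \<epsilon> T b m j \<omega>)) (prod_emb I (\<lambda>_. borel) J (Pi\<^sub>E J A))
      = emeasure (distr M ?Q (inc b m)) {p\<in>space ?Q. \<forall>j\<in>J. G j p \<in> A j}"
    if m: "(\<lambda>\<omega>. \<lambda>j\<in>I. joint_process s \<epsilon> T b m j \<omega>) \<in> measurable M ?P"
      and inc: "inc b m \<in> measurable M ?Q"
      and 0: "\<And>\<omega>. \<omega> \<in> space M \<Longrightarrow> b 0 \<omega> = 0" "\<And>\<omega>. \<omega> \<in> space M \<Longrightarrow> m 0 \<omega> = 0" for b m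
  proof -
    have "{p\<in>space ?Q. \<forall>j\<in>J. G j p \<in> A j} \<in> sets ?Q"
    proof (rule sets.sets_Collect_finite_All[OF _ J(1)])
      fix j assume "j \<in> J"
      then have [measurable]: "G j \<in> borel_measurable ?Q" "A j \<in> sets borel" using A by auto
      show "{p\<in>space ?Q. G j p \<in> A j} \<in> sets ?Q" by measurable
    qed
    moreover have "prod_emb I (\<lambda>_. borel) J (Pi\<^sub>E J A) \<in> sets ?P"
      using J A by (intro sets_PiM_I) auto
    moreover have "(\<lambda>\<omega>. \<lambda>j\<in>I. joint_process s \<epsilon> T b m j \<omega>) -` prod_emb I (\<lambda>_. borel) J (Pi\<^sub>E J A) \<inter> space M
        = inc b m -` {p\<in>space ?Q. \<forall>j\<in>J. G j p \<in> A j} \<inter> space M"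
      using J measurable_space[OF inc] G 0
      by (auto simp: prod_emb_def PiE_iff restrict_def extensional_def) (metis G in_mono)+
    ultimately show ?thesis using m inc by (simp add: emeasure_distr)
  qed
  have t_nonneg: "0 \<le> t i" if "i \<le> n" for i
    using that
  proof (induction i)
    case (Suc i)
    then show ?case using t(3)[of i] by simp
  qed (use t in simp)
  have mi: "inc B N \<in> measurable M ?Q" "inc (reflected_B \<epsilon>) (reflected_N \<epsilon>) \<in> measurable M ?Q"
    unfolding inc_def[abs_def] using t_nonneg by (auto intro!: measurable_restrict measurable_Pair borel_measurable_diff
      B.measurable_W N.measurable_W measurable_reflected)
  have "distr M ?Q (inc (reflected_B \<epsilon>) (reflected_N \<epsilon>)) = distr M ?Q (inc B N)"
    using increments_reflection[of \<epsilon> t n, OF \<epsilon> _ t(3) t(2)] t(1) by (simp add: inc_def[abs_def])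
  then show "emeasure (distr M ?P ?U') (prod_emb I (\<lambda>_. borel) J (Pi\<^sub>E J A))
      = emeasure (distr M ?P ?U) (prod_emb I (\<lambda>_. borel) J (Pi\<^sub>E J A))"
    using em[OF mU(1) mi(1)] em[OF mU(2) mi(2)] B.W_0 N.W_0
    by (simp add: reflected_B_def reflected_N_def)
qed simp_all

text \<open>Splitting off the index \<open>- 1\<close> turns the equality of laws into one for the
  pair of observed path and noise value. The observed path is the same function of \<omega> on both
  sides; only the second component is reflected.\<close>

lemma observation_reflection:
  assumes \<epsilon>: "0 < \<epsilon>" and T: "0 < T" and f: "f \<in> borel_measurable (path_space \<Otimes>\<^sub>M borel)"
  shows "(\<integral>\<^sup>+\<omega>. f (path (observation s \<epsilon> B N) \<omega>, reflected_B \<epsilon> T \<omega>) \<partial>M)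
    = (\<integral>\<^sup>+\<omega>. f (path (observation s \<epsilon> B N) \<omega>, B T \<omega>) \<partial>M)"
proof -
  let ?I = "insert (- 1) {0..} :: real set"
  let ?P = "PiM ?I (\<lambda>_. borel :: real measure)"
  let ?h = "\<lambda>u::real \<Rightarrow> real. (restrict u {0..}, u (- 1))"
  have h: "?h \<in> measurable ?P (path_space \<Otimes>\<^sub>M borel)"
    unfolding path_space_def by (intro measurable_Pair measurable_restrict_subset measurable_component_singleton) auto
  have mU: "(\<lambda>\<omega>. \<lambda>j\<in>?I. joint_process s \<epsilon> T B N j \<omega>) \<in> measurable M ?P"
    "(\<lambda>\<omega>. \<lambda>j\<in>?I. joint_process s \<epsilon> T (reflected_B \<epsilon>) (reflected_N \<epsilon>) j \<omega>) \<in> measurable M ?P"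
    by (intro measurable_joint_process B.measurable_W N.measurable_W measurable_reflected less_imp_le[OF T]; assumption)+
  have eq: "?h (\<lambda>j\<in>?I. joint_process s \<epsilon> T (reflected_B \<epsilon>) (reflected_N \<epsilon>) j \<omega>)
      = (path (observation s \<epsilon> B N) \<omega>, reflected_B \<epsilon> T \<omega>)"
    "?h (\<lambda>j\<in>?I. joint_process s \<epsilon> T B N j \<omega>) = (path (observation s \<epsilon> B N) \<omega>, B T \<omega>)" for \<omega>
    using reflected_observation[of \<epsilon> _ \<omega>]
    by (auto simp: joint_process_def path_def observation_def signal_def fun_eq_iff restrict_def algebra_simps)
  have "(\<integral>\<^sup>+\<omega>. f (?h (\<lambda>j\<in>?I. joint_process s \<epsilon> T (reflected_B \<epsilon>) (reflected_N \<epsilon>) j \<omega>)) \<partial>M)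
      = (\<integral>\<^sup>+u. f (?h u) \<partial>distr M ?P (\<lambda>\<omega>. \<lambda>j\<in>?I. joint_process s \<epsilon> T (reflected_B \<epsilon>) (reflected_N \<epsilon>) j \<omega>))"
    by (rule nn_integral_distr[OF mU(2), symmetric]) (use measurable_compose[OF h f] in simp)
  also have "\<dots> = (\<integral>\<^sup>+\<omega>. f (?h (\<lambda>j\<in>?I. joint_process s \<epsilon> T B N j \<omega>)) \<partial>M)"
    unfolding joint_process_reflection[OF \<epsilon> T]
    by (rule nn_integral_distr[OF mU(1)]) (use measurable_compose[OF h f] in simp)
  finally show ?thesis unfolding eq .
qed

end

section \<open>Mean errors\<close>

text \<open>Integrates the pathwise bound of \<open>hitting_time_linearization\<close>, which
  applies almost everywhere because an integrable \<open>V\<close> is almost everywhere finite. The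
  measurable majorant \<open>R\<close> is all that later arguments need to know about the hitting
  time.\<close>

lemma (in prob_space) hitting_time_near_linearization:
  fixes x :: "real \<Rightarrow> 'a \<Rightarrow> real" and l s :: real
  defines "T \<equiv> l / s"
  assumes xT[measurable]: "x T \<in> borel_measurable M" and x0: "\<And>\<omega>. \<omega> \<in> space M \<Longrightarrow> x 0 \<omega> = 0"
    and cont: "AE \<omega> in M. continuous_on {0..} (\<lambda>t. x t \<omega>)"
    and s: "0 < s" and l: "0 < l" and b: "0 < b" "b \<le> s / 2"
    and V[measurable]: "V \<in> borel_measurable M" and intV: "(\<integral>\<^sup>+\<omega>. V \<omega> \<partial>M) \<le> ennreal C"
    and dom: "AE \<omega> in M. \<forall>t\<ge>0. ennreal \<bar>x t \<omega> - x T \<omega>\<bar> \<le> ennreal (b * \<bar>t - T\<bar>) + V \<omega>"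
    and int_x: "(\<integral>\<^sup>+\<omega>. ennreal \<bar>x T \<omega>\<bar> \<partial>M) \<le> ennreal m" and Cm: "0 \<le> C" "0 \<le> m"
  shows "\<exists>R\<in>borel_measurable M. (\<integral>\<^sup>+\<omega>. R \<omega> \<partial>M) \<le> ennreal (2 * b / s\<^sup>2 * m + 2 / s * C) \<and>
    (AE \<omega> in M. \<exists>h. hitting_time (\<lambda>t \<omega>. x t \<omega> + s * t) l \<omega> = ereal h \<and> ennreal \<bar>h - (T - x T \<omega> / s)\<bar> \<le> R \<omega>)"
proof (intro bexI conjI)
  define R where "R \<omega> = ennreal (2 * b / s\<^sup>2) * ennreal \<bar>x T \<omega>\<bar> + ennreal (2 / s) * V \<omega>" for \<omega>
  show "R \<in> borel_measurable M" unfolding R_def by measurable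
  have "(\<integral>\<^sup>+\<omega>. R \<omega> \<partial>M) = ennreal (2 * b / s\<^sup>2) * (\<integral>\<^sup>+\<omega>. ennreal \<bar>x T \<omega>\<bar> \<partial>M) + ennreal (2 / s) * (\<integral>\<^sup>+\<omega>. V \<omega> \<partial>M)"
    unfolding R_def by (simp add: nn_integral_add nn_integral_cmult)
  also have "\<dots> \<le> ennreal (2 * b / s\<^sup>2) * ennreal m + ennreal (2 / s) * ennreal C"
    by (intro add_mono mult_left_mono int_x intV) auto
  also have "\<dots> = ennreal (2 * b / s\<^sup>2 * m + 2 / s * C)"
    using s b Cm by (simp add: ennreal_mult'[symmetric])
  finally show "(\<integral>\<^sup>+\<omega>. R \<omega> \<partial>M) \<le> ennreal (2 * b / s\<^sup>2 * m + 2 / s * C)" .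
  have "(\<integral>\<^sup>+\<omega>. V \<omega> \<partial>M) \<noteq> \<infinity>" using intV by (auto simp: top_unique)
  then have "AE \<omega> in M. V \<omega> \<noteq> \<infinity>" by (intro nn_integral_PInf_AE) auto
  then show "AE \<omega> in M. \<exists>h. hitting_time (\<lambda>t \<omega>. x t \<omega> + s * t) l \<omega> = ereal h \<and> ennreal \<bar>h - (T - x T \<omega> / s)\<bar> \<le> R \<omega>"
    using cont dom AE_space
  proof eventually_elim
    case (elim \<omega>)
    then obtain v where v: "V \<omega> = ennreal v" "0 \<le> v" by (cases "V \<omega>") auto
    have "\<bar>x t \<omega> - x T \<omega>\<bar> \<le> b * \<bar>t - T\<bar> + v" if "0 \<le> t" for t
    proof -
      have "ennreal \<bar>x t \<omega> - x T \<omega>\<bar> \<le> ennreal (b * \<bar>t - T\<bar> + v)"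
        using elim(3)[rule_format, OF that] v b by simp
      then show ?thesis using v b by (subst (asm) ennreal_le_iff) auto
    qed
    from hitting_time_linearization[of "\<lambda>t. x t \<omega>" s l b v, folded T_def, OF elim(2) x0[OF elim(4)] s l b v(2) this]
    obtain h where h: "Inf (ereal ` {t. 0 \<le> t \<and> l \<le> x t \<omega> + s * t}) = ereal h"
      and le: "\<bar>h - (T - x T \<omega> / s)\<bar> \<le> 2 * b / s\<^sup>2 * \<bar>x T \<omega>\<bar> + 2 * v / s" by blast
    have "R \<omega> = ennreal (2 * b / s\<^sup>2 * \<bar>x T \<omega>\<bar> + 2 * v / s)"
      using s b v by (simp add: R_def ennreal_mult'[symmetric])
    then show ?case using h ennreal_leI[OF le] by (auto simp: hitting_time_def)
  qed
qed

lemma (in wiener) nn_integral_abs_le: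
  assumes "0 < t"
  shows "(\<integral>\<^sup>+\<omega>. ennreal \<bar>W t \<omega>\<bar> \<partial>M) \<le> ennreal (sqrt t)"
proof -
  have "sqrt (2 / pi) \<le> 1" using pi_ge_two by simp
  then have "sqrt t * sqrt (2 / pi) \<le> sqrt t" using assms by (intro mult_left_le) auto
  then show ?thesis
    using normal_nn_integral_abs[OF W_normal[OF assms]] assms by (simp add: ennreal_leI)
qed

section \<open>The estimated noise and the error of the two kinds of estimators\<close>

context wiener_pair
begin

text \<open>The conditional mean of \<open>B t\<close> given the observation: the component of
  \<open>B t\<close> along the direction \<open>(1, \<epsilon>)\<close>, which the reflection leaves
  fixed.\<close>

definition Z :: "real \<Rightarrow> real \<Rightarrow> 'a \<Rightarrow> real" where
  "Z \<epsilon> t \<omega> = (B t \<omega> + \<epsilon> * N t \<omega>) / (1 + \<epsilon>\<^sup>2)"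

lemma measurable_Z: "0 \<le> t \<Longrightarrow> Z \<epsilon> t \<in> borel_measurable M"
  unfolding Z_def[abs_def] using B.measurable_W[of t] N.measurable_W[of t] by measurable

lemma signal_estimate_eq: "signal_estimate s \<epsilon> B N = (\<lambda>t \<omega>. Z \<epsilon> t \<omega> + s * t)"
  by (simp add: fun_eq_iff signal_estimate_def observation_def signal_def Z_def)

lemma signal_eq: "signal s B = (\<lambda>t \<omega>. B t \<omega> + s * t)"
  by (simp add: fun_eq_iff signal_def)

text \<open>The reflection negates \<open>B - Z\<close> and fixes \<open>Z\<close>, so a value and
  its mirror image differ by twice the estimation error.\<close>

lemma reflected_diff: "B t \<omega> - reflected_B \<epsilon> t \<omega> = 2 * (B t \<omega> - Z \<epsilon> t \<omega>)"
proof -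
  have p: "1 + \<epsilon>\<^sup>2 \<noteq> 0" by (metis add_pos_nonneg less_irrefl zero_le_power2 zero_less_one)
  define E where "E = 1 + \<epsilon>\<^sup>2"
  have num: "1 - \<epsilon>\<^sup>2 = 2 - E" and E: "E \<noteq> 0" using p by (auto simp: E_def)
  from E show ?thesis unfolding reflected_B_def Z_def num E_def[symmetric]
    by (simp add: field_simps)
qed

text \<open>Both coefficients of \<open>Z\<close> are at most one in absolute value. Hence
  \<open>Z\<close> inherits its domination from \<open>B\<close> and \<open>N\<close>, with
  constants that do not depend on \<epsilon>.\<close>

lemma Z_diff_le: "\<bar>Z \<epsilon> t \<omega> - Z \<epsilon> r \<omega>\<bar> \<le> \<bar>B t \<omega> - B r \<omega>\<bar> + \<bar>N t \<omega> - N r \<omega>\<bar>"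
proof -
  have p: "1 + \<epsilon>\<^sup>2 > 0" by (simp add: add_pos_nonneg)
  have "0 \<le> (1 - \<bar>\<epsilon>\<bar>)\<^sup>2" by simp
  then have e: "\<bar>\<epsilon>\<bar> \<le> 1 + \<epsilon>\<^sup>2" by (simp add: power2_eq_square algebra_simps abs_mult_self_eq)
  have "Z \<epsilon> t \<omega> - Z \<epsilon> r \<omega> = ((B t \<omega> - B r \<omega>) + \<epsilon> * (N t \<omega> - N r \<omega>)) / (1 + \<epsilon>\<^sup>2)"
    by (simp add: Z_def diff_divide_distrib[symmetric] algebra_simps)
  then have "\<bar>Z \<epsilon> t \<omega> - Z \<epsilon> r \<omega>\<bar> = \<bar>(B t \<omega> - B r \<omega>) + \<epsilon> * (N t \<omega> - N r \<omega>)\<bar> / (1 + \<epsilon>\<^sup>2)"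
    using p by simp
  also have "\<dots> \<le> (1 * \<bar>B t \<omega> - B r \<omega>\<bar> + \<bar>\<epsilon>\<bar> * \<bar>N t \<omega> - N r \<omega>\<bar>) / (1 + \<epsilon>\<^sup>2)"
    using p by (intro divide_right_mono) (auto simp: abs_mult[symmetric])
  also have "\<dots> \<le> ((1 + \<epsilon>\<^sup>2) * \<bar>B t \<omega> - B r \<omega>\<bar> + (1 + \<epsilon>\<^sup>2) * \<bar>N t \<omega> - N r \<omega>\<bar>) / (1 + \<epsilon>\<^sup>2)"
    using p e by (intro divide_right_mono add_mono mult_right_mono) auto
  also have "\<dots> = \<bar>B t \<omega> - B r \<omega>\<bar> + \<bar>N t \<omega> - N r \<omega>\<bar>"
    using p by (simp add: distrib_left[symmetric])
  finally show ?thesis .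
qed

text \<open>The error is a combination of the independent normal variables \<open>B T\<close> and
  \<open>N T\<close> with coefficients \<open>\<epsilon>\<^sup>2 / E\<close> and
  \<open>- \<epsilon> / E\<close>. The variances add up to \<open>v\<close>, and a centred normal
  variable has mean absolute value \<open>sqrt (2 / pi)\<close> times its standard
  deviation.\<close>

lemma estimation_error_abs:
  assumes \<epsilon>: "0 < \<epsilon>" and s: "0 < s" and l: "0 < l"
  shows "(\<integral>\<^sup>+\<omega>. ennreal (\<bar>B (l / s) \<omega> - Z \<epsilon> (l / s) \<omega>\<bar> / s) \<partial>M) = ennreal (error_rate l s \<epsilon>)"
proof -
  define T where "T = l / s"
  define E where "E = 1 + \<epsilon>\<^sup>2"
  have E: "0 < E" by (auto simp: E_def add_pos_nonneg)
  have T: "0 < T" using s l by (simp add: T_def)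
  have [measurable]: "B T \<in> borel_measurable M" "N T \<in> borel_measurable M"
    using B.measurable_W N.measurable_W T by auto
  have ZT [measurable]: "Z \<epsilon> T \<in> borel_measurable M" using measurable_Z T by simp
  have "B.indep_var borel (\<lambda>\<omega>. (\<lambda>y. \<epsilon>\<^sup>2 / E * y T) (path B \<omega>)) borel (\<lambda>\<omega>. (\<lambda>y. - \<epsilon> / E * y T) (path N \<omega>))"
    using T by (intro indep_compose borel_measurable_times borel_measurable_const measurable_path_component) auto
  then have ind: "B.indep_var borel (\<lambda>\<omega>. \<epsilon>\<^sup>2 / E * B T \<omega>) borel (\<lambda>\<omega>. - \<epsilon> / E * N T \<omega>)"
    using T by (simp add: path_def)
  have nB: "distributed M lborel (\<lambda>\<omega>. \<epsilon>\<^sup>2 / E * B T \<omega>) (normal_density 0 (\<epsilon>\<^sup>2 / E * sqrt T))"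
    using B.normal_density_affine[OF B.W_normal[OF T], of "\<epsilon>\<^sup>2 / E" 0] \<epsilon> E T by simp
  have nN: "distributed M lborel (\<lambda>\<omega>. - \<epsilon> / E * N T \<omega>) (normal_density 0 (\<epsilon> / E * sqrt T))"
    using B.normal_density_affine[OF N.W_normal[OF T], of "- \<epsilon> / E" 0] \<epsilon> E T by simp
  define v where "v = \<epsilon>\<^sup>2 / E * T"
  have v: "0 < v" using \<epsilon> E T by (simp add: v_def)
  have var: "(\<epsilon>\<^sup>2 / E * sqrt T)\<^sup>2 + (\<epsilon> / E * sqrt T)\<^sup>2 = v"
  proof -
    have "(\<epsilon>\<^sup>2 / E * sqrt T)\<^sup>2 + (\<epsilon> / E * sqrt T)\<^sup>2 = ((\<epsilon>\<^sup>2)\<^sup>2 + \<epsilon>\<^sup>2) * T / E\<^sup>2"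
      using T by (simp add: power_mult_distrib power_divide add_divide_distrib distrib_right)
    also have "(\<epsilon>\<^sup>2)\<^sup>2 + \<epsilon>\<^sup>2 = \<epsilon>\<^sup>2 * E" by (simp add: E_def power2_eq_square algebra_simps)
    finally show ?thesis using E by (simp add: v_def power2_eq_square)
  qed
  have eq: "B T \<omega> - Z \<epsilon> T \<omega> = \<epsilon>\<^sup>2 / E * B T \<omega> + - \<epsilon> / E * N T \<omega>" for \<omega>
  proof -
    have e2: "\<epsilon>\<^sup>2 / E = 1 - 1 / E" using E by (simp add: E_def field_simps)
    show ?thesis unfolding Z_def E_def[symmetric] e2 by (simp add: algebra_simps add_divide_distrib)
  qed
  have "distributed M lborel (\<lambda>\<omega>. B T \<omega> - Z \<epsilon> T \<omega>) (normal_density 0 (sqrt v))"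
    using B.add_indep_normal[OF ind _ _ nB nN] \<epsilon> E T unfolding var eq by simp
  then have "(\<integral>\<^sup>+\<omega>. ennreal \<bar>B T \<omega> - Z \<epsilon> T \<omega>\<bar> \<partial>M) = ennreal (sqrt v * sqrt (2 / pi))"
    using v by (intro normal_nn_integral_abs) auto
  moreover have "(\<integral>\<^sup>+\<omega>. ennreal (\<bar>B T \<omega> - Z \<epsilon> T \<omega>\<bar> / s) \<partial>M) = (\<integral>\<^sup>+\<omega>. ennreal (1 / s) * ennreal \<bar>B T \<omega> - Z \<epsilon> T \<omega>\<bar> \<partial>M)"
    using s by (intro nn_integral_cong) (simp add: ennreal_mult[symmetric])
  moreover have "\<dots> = ennreal (1 / s) * (\<integral>\<^sup>+\<omega>. ennreal \<bar>B T \<omega> - Z \<epsilon> T \<omega>\<bar> \<partial>M)"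
    by (rule nn_integral_cmult) measurable
  moreover have "1 / s * (sqrt v * sqrt (2 / pi)) = error_rate l s \<epsilon>"
  proof -
    have "1 / s = sqrt (1 / s\<^sup>2)" using s by (simp add: real_sqrt_divide)
    then have "1 / s * (sqrt v * sqrt (2 / pi)) = sqrt (1 / s\<^sup>2 * (v * (2 / pi)))"
      by (simp only: real_sqrt_mult)
    also have "1 / s\<^sup>2 * (v * (2 / pi)) = 2 * l * \<epsilon>\<^sup>2 / (pi * s ^ 3 * (1 + \<epsilon>\<^sup>2))"
      using s unfolding v_def T_def E_def by (simp add: power2_eq_square power3_eq_cube mult_ac)
    finally show ?thesis by (simp add: error_rate_def)
  qed
  ultimately show ?thesis using s v by (simp add: T_def[symmetric] ennreal_mult[symmetric])
qed

text \<open>By reflection an estimator has the same mean error against \<open>T - B T / s\<close> as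
  against the mirrored target. The average of the two errors is at least half the distance of the
  targets, whose mean is the rate; passing from the linearized target to the hitting time costs at
  most \<open>r\<close>.\<close>

lemma optimal_error_lower:
  assumes \<epsilon>: "0 < \<epsilon>" and s: "0 < s" and l: "0 < l"
    and R [measurable]: "R \<in> borel_measurable M" and intR: "(\<integral>\<^sup>+\<omega>. R \<omega> \<partial>M) \<le> ennreal r"
    and H: "AE \<omega> in M. \<exists>h. hitting_time (signal s B) l \<omega> = ereal h \<and> ennreal \<bar>h - (l / s - B (l / s) \<omega> / s)\<bar> \<le> R \<omega>"
    and r: "0 \<le> r"
  shows "ennreal (error_rate l s \<epsilon> - r) \<le> optimal_error M B N l s \<epsilon>"
  unfolding optimal_error_def
proof (rule INF_greatest)
  fix \<eta> :: "(real \<Rightarrow> real) \<Rightarrow> ereal" assume \<eta> [measurable]: "\<eta> \<in> borel_measurable path_space"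
  define T where "T = l / s"
  have T: "0 < T" using s l by (simp add: T_def)
  have [measurable]: "B T \<in> borel_measurable M" "reflected_B \<epsilon> T \<in> borel_measurable M"
    using B.measurable_W measurable_reflected T by auto
  have [measurable]: "path (observation s \<epsilon> B N) \<in> measurable M path_space"
    unfolding path_space_def path_def
  proof (rule measurable_restrict)
    fix t :: real assume "t \<in> {0..}"
    then have [measurable]: "B t \<in> borel_measurable M" "N t \<in> borel_measurable M"
      using B.measurable_W N.measurable_W by auto
    show "observation s \<epsilon> B N t \<in> borel_measurable M"
      unfolding observation_def[abs_def] signal_def by measurable
  qed
  \<comment> \<open>The error against the linearized target, written as a function of the observed
    path and the noise value so that \<open>observation_reflection\<close> applies.\<close>
  define F where "F p = e2ennreal \<bar>\<eta> (fst p) - ereal (T - snd p / s)\<bar>" for p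
  have F [measurable]: "F \<in> borel_measurable (path_space \<Otimes>\<^sub>M borel)" unfolding F_def by measurable
  let ?Y = "path (observation s \<epsilon> B N)"
  have "ennreal (error_rate l s \<epsilon>) = (\<integral>\<^sup>+\<omega>. ennreal (\<bar>B T \<omega> - Z \<epsilon> T \<omega>\<bar> / s) \<partial>M)"
    using estimation_error_abs[OF \<epsilon> s l] by (simp add: T_def)
  also have "\<dots> \<le> (\<integral>\<^sup>+\<omega>. ennreal (1 / 2) * (F (?Y \<omega>, B T \<omega>) + F (?Y \<omega>, reflected_B \<epsilon> T \<omega>)) \<partial>M)"
  proof (intro nn_integral_mono)
    fix \<omega>
    have twice: "2 * (\<bar>B T \<omega> - Z \<epsilon> T \<omega>\<bar> / s) = \<bar>(T - B T \<omega> / s) - (T - reflected_B \<epsilon> T \<omega> / s)\<bar>"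
    proof -
      have "(T - B T \<omega> / s) - (T - reflected_B \<epsilon> T \<omega> / s) = - ((B T \<omega> - reflected_B \<epsilon> T \<omega>) / s)"
        by (simp add: diff_divide_distrib)
      also have "\<dots> = - (2 * ((B T \<omega> - Z \<epsilon> T \<omega>) / s))" unfolding reflected_diff by simp
      finally show ?thesis using s by (simp only: abs_minus_cancel abs_mult abs_divide)
    qed
    have "\<bar>B T \<omega> - Z \<epsilon> T \<omega>\<bar> / s = 1 / 2 * \<bar>(T - B T \<omega> / s) - (T - reflected_B \<epsilon> T \<omega> / s)\<bar>"
      unfolding twice[symmetric] by simp
    then have "ennreal (\<bar>B T \<omega> - Z \<epsilon> T \<omega>\<bar> / s) = ennreal (1 / 2) * ennreal \<bar>(T - B T \<omega> / s) - (T - reflected_B \<epsilon> T \<omega> / s)\<bar>"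
      by (simp only: ennreal_mult' abs_ge_zero)
    also have "\<dots> \<le> ennreal (1 / 2) * (F (?Y \<omega>, B T \<omega>) + F (?Y \<omega>, reflected_B \<epsilon> T \<omega>))"
    proof (intro mult_left_mono)
      show "ennreal \<bar>(T - B T \<omega> / s) - (T - reflected_B \<epsilon> T \<omega> / s)\<bar> \<le> F (?Y \<omega>, B T \<omega>) + F (?Y \<omega>, reflected_B \<epsilon> T \<omega>)"
        by (cases "\<eta> (?Y \<omega>)")
          (auto simp: F_def e2ennreal_abs_diff_ereal simp flip: ennreal_plus intro!: ennreal_leI)
    qed simp
    finally show "ennreal (\<bar>B T \<omega> - Z \<epsilon> T \<omega>\<bar> / s) \<le> ennreal (1 / 2) * (F (?Y \<omega>, B T \<omega>) + F (?Y \<omega>, reflected_B \<epsilon> T \<omega>))" .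
  qed
  also have "\<dots> = ennreal (1 / 2) * ((\<integral>\<^sup>+\<omega>. F (?Y \<omega>, B T \<omega>) \<partial>M) + (\<integral>\<^sup>+\<omega>. F (?Y \<omega>, reflected_B \<epsilon> T \<omega>) \<partial>M))"
    by (subst nn_integral_cmult) (auto simp: nn_integral_add)
  also have "(\<integral>\<^sup>+\<omega>. F (?Y \<omega>, reflected_B \<epsilon> T \<omega>) \<partial>M) = (\<integral>\<^sup>+\<omega>. F (?Y \<omega>, B T \<omega>) \<partial>M)"
    by (rule observation_reflection[OF \<epsilon> T F])
  also have "ennreal (1 / 2) * ((\<integral>\<^sup>+\<omega>. F (?Y \<omega>, B T \<omega>) \<partial>M) + (\<integral>\<^sup>+\<omega>. F (?Y \<omega>, B T \<omega>) \<partial>M)) = (\<integral>\<^sup>+\<omega>. F (?Y \<omega>, B T \<omega>) \<partial>M)"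
  proof -
    have "ennreal (1 / 2) * (x + x) = x" for x :: ennreal
    proof -
      have "ennreal (1 / 2) * (x + x) = (ennreal (1 / 2) + ennreal (1 / 2)) * x"
        by (simp only: distrib_left distrib_right)
      also have "ennreal (1 / 2) + ennreal (1 / 2) = 1" by (subst ennreal_plus[symmetric]) auto
      finally show ?thesis by simp
    qed
    then show ?thesis .
  qed
  also have "\<dots> \<le> mean_abs_error M (\<lambda>\<omega>. \<eta> (?Y \<omega>)) (hitting_time (signal s B) l) + (\<integral>\<^sup>+\<omega>. R \<omega> \<partial>M)"
    unfolding mean_abs_error_def
  proof (rule le_nn_integral_add)
    show "AE \<omega> in M. F (?Y \<omega>, B T \<omega>) \<le> e2ennreal \<bar>\<eta> (?Y \<omega>) - hitting_time (signal s B) l \<omega>\<bar> + R \<omega>"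
      using H
    proof eventually_elim
      case (elim \<omega>)
      then obtain h where h: "hitting_time (signal s B) l \<omega> = ereal h" "ennreal \<bar>h - (T - B T \<omega> / s)\<bar> \<le> R \<omega>"
        by (auto simp: T_def)
      then show ?case
        using e2ennreal_abs_triangle[of "\<eta> (?Y \<omega>)" "T - B T \<omega> / s" h]
        by (auto simp: F_def intro: order_trans add_left_mono)
    qed
  qed measurable
  also have "\<dots> \<le> mean_abs_error M (\<lambda>\<omega>. \<eta> (?Y \<omega>)) (hitting_time (signal s B) l) + ennreal r"
    by (intro add_left_mono intR)
  finally have "ennreal (error_rate l s \<epsilon>) - ennreal r \<le> mean_abs_error M (\<lambda>\<omega>. \<eta> (?Y \<omega>)) (hitting_time (signal s B) l)"
    by (simp add: ennreal_minus_le_iff add.commute)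
  then show "ennreal (error_rate l s \<epsilon> - r) \<le> mean_abs_error M (\<lambda>\<omega>. \<eta> (?Y \<omega>)) (hitting_time (signal s B) l)"
    using r by (simp add: ennreal_minus)
qed

text \<open>The estimator \<open>T - Z T / s\<close> has the linearized error of mean
  \<open>error_rate l s \<epsilon>\<close>, and replacing the linearized target by the hitting time
  adds at most \<open>r\<close>.\<close>

lemma optimal_error_upper:
  assumes \<epsilon>: "0 < \<epsilon>" and s: "0 < s" and l: "0 < l"
    and R [measurable]: "R \<in> borel_measurable M" and intR: "(\<integral>\<^sup>+\<omega>. R \<omega> \<partial>M) \<le> ennreal r"
    and H: "AE \<omega> in M. \<exists>h. hitting_time (signal s B) l \<omega> = ereal h \<and> ennreal \<bar>h - (l / s - B (l / s) \<omega> / s)\<bar> \<le> R \<omega>"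
    and r: "0 \<le> r"
  shows "optimal_error M B N l s \<epsilon> \<le> ennreal (error_rate l s \<epsilon> + r)"
proof -
  define T where "T = l / s"
  have T: "0 < T" using s l by (simp add: T_def)
  have [measurable]: "B T \<in> borel_measurable M" "Z \<epsilon> T \<in> borel_measurable M"
    using B.measurable_W measurable_Z T by auto
  have [measurable]: "(\<lambda>y. y T) \<in> borel_measurable path_space" using T by (intro measurable_path_component) simp
  \<comment> \<open>The value \<open>Z T\<close> is computed from the observation at the single time
    \<open>T\<close>.\<close>
  define \<eta> where "\<eta> y = ereal (T - (y T - s * T) / (1 + \<epsilon>\<^sup>2) / s)" for y :: "real \<Rightarrow> real"
  have [measurable]: "\<eta> \<in> borel_measurable path_space" unfolding \<eta>_def by measurable
  have \<eta>: "\<eta> (path (observation s \<epsilon> B N) \<omega>) = ereal (T - Z \<epsilon> T \<omega> / s)" for \<omega>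
    using T by (simp add: \<eta>_def path_def observation_def signal_def Z_def)
  have "optimal_error M B N l s \<epsilon> \<le> mean_abs_error M (\<lambda>\<omega>. \<eta> (path (observation s \<epsilon> B N) \<omega>)) (hitting_time (signal s B) l)"
    unfolding optimal_error_def by (rule INF_lower) measurable
  also have "\<dots> \<le> (\<integral>\<^sup>+\<omega>. ennreal (\<bar>B T \<omega> - Z \<epsilon> T \<omega>\<bar> / s) + R \<omega> \<partial>M)"
    unfolding mean_abs_error_def \<eta>
  proof (rule nn_integral_mono_AE)
    show "AE \<omega> in M. e2ennreal \<bar>ereal (T - Z \<epsilon> T \<omega> / s) - hitting_time (signal s B) l \<omega>\<bar> \<le> ennreal (\<bar>B T \<omega> - Z \<epsilon> T \<omega>\<bar> / s) + R \<omega>"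
      using H
    proof eventually_elim
      case (elim \<omega>)
      then obtain h where h: "hitting_time (signal s B) l \<omega> = ereal h" "ennreal \<bar>h - (T - B T \<omega> / s)\<bar> \<le> R \<omega>"
        by (auto simp: T_def)
      have "\<bar>(T - Z \<epsilon> T \<omega> / s) - h\<bar> \<le> \<bar>(B T \<omega> - Z \<epsilon> T \<omega>) / s\<bar> + \<bar>h - (T - B T \<omega> / s)\<bar>"
        by (simp add: diff_divide_distrib)
      then have "\<bar>(T - Z \<epsilon> T \<omega> / s) - h\<bar> \<le> \<bar>B T \<omega> - Z \<epsilon> T \<omega>\<bar> / s + \<bar>h - (T - B T \<omega> / s)\<bar>"
        using s by simp
      from ennreal_leI[OF this] have "ennreal \<bar>(T - Z \<epsilon> T \<omega> / s) - h\<bar> \<le> ennreal (\<bar>B T \<omega> - Z \<epsilon> T \<omega>\<bar> / s) + ennreal \<bar>h - (T - B T \<omega> / s)\<bar>"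
        using s by simp
      also have "\<dots> \<le> ennreal (\<bar>B T \<omega> - Z \<epsilon> T \<omega>\<bar> / s) + R \<omega>"
        by (intro add_left_mono h)
      finally show ?case unfolding h(1) e2ennreal_abs_diff_ereal .
    qed
  qed
  also have "\<dots> = ennreal (error_rate l s \<epsilon>) + (\<integral>\<^sup>+\<omega>. R \<omega> \<partial>M)"
    using estimation_error_abs[OF \<epsilon> s l] by (subst nn_integral_add) (auto simp: T_def[symmetric])
  also have "\<dots> \<le> ennreal (error_rate l s \<epsilon>) + ennreal r" by (intro add_left_mono intR)
  also have "\<dots> = ennreal (error_rate l s \<epsilon> + r)"
    using r s l by (intro ennreal_plus[symmetric]) (auto simp: error_rate_def)
  finally show ?thesis .
qed

text \<open>Both hitting times are replaced by their linearizations, each at a mean cost of at most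
  \<open>r\<close>, and the linearizations differ by
  \<open>\<bar>B T - Z T\<bar> / s\<close>.\<close>

lemma hitting_error_bounds:
  assumes \<epsilon>: "0 < \<epsilon>" and s: "0 < s" and l: "0 < l"
    and R [measurable]: "R \<in> borel_measurable M" and intR: "(\<integral>\<^sup>+\<omega>. R \<omega> \<partial>M) \<le> ennreal r"
    and H: "AE \<omega> in M. \<exists>h. hitting_time (signal s B) l \<omega> = ereal h \<and> ennreal \<bar>h - (l / s - B (l / s) \<omega> / s)\<bar> \<le> R \<omega>"
    and Q [measurable]: "Q \<in> borel_measurable M" and intQ: "(\<integral>\<^sup>+\<omega>. Q \<omega> \<partial>M) \<le> ennreal r"
    and K: "AE \<omega> in M. \<exists>h. hitting_time (signal_estimate s \<epsilon> B N) l \<omega> = ereal h \<and> ennreal \<bar>h - (l / s - Z \<epsilon> (l / s) \<omega> / s)\<bar> \<le> Q \<omega>"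
    and r: "0 \<le> r"
  shows "ennreal (error_rate l s \<epsilon> - 2 * r) \<le> hitting_error M B N l s \<epsilon>"
    and "hitting_error M B N l s \<epsilon> \<le> ennreal (error_rate l s \<epsilon> + 2 * r)"
proof -
  define T where "T = l / s"
  have T: "0 < T" using s l by (simp add: T_def)
  have [measurable]: "B T \<in> borel_measurable M" "Z \<epsilon> T \<in> borel_measurable M"
    using B.measurable_W measurable_Z T by auto
  have rate: "(\<integral>\<^sup>+\<omega>. ennreal (\<bar>B T \<omega> - Z \<epsilon> T \<omega>\<bar> / s) \<partial>M) = ennreal (error_rate l s \<epsilon>)"
    using estimation_error_abs[OF \<epsilon> s l] by (simp add: T_def)
  have intRQ: "(\<integral>\<^sup>+\<omega>. R \<omega> + Q \<omega> \<partial>M) \<le> ennreal (2 * r)"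
  proof -
    have "(\<integral>\<^sup>+\<omega>. R \<omega> + Q \<omega> \<partial>M) \<le> ennreal r + ennreal r"
      by (subst nn_integral_add) (auto intro: add_mono intR intQ)
    also have "\<dots> = ennreal (2 * r)" using r by (subst ennreal_plus[symmetric]) auto
    finally show ?thesis .
  qed
  have AE: "AE \<omega> in M. ennreal (\<bar>B T \<omega> - Z \<epsilon> T \<omega>\<bar> / s)
        \<le> e2ennreal \<bar>hitting_time (signal_estimate s \<epsilon> B N) l \<omega> - hitting_time (signal s B) l \<omega>\<bar> + (R \<omega> + Q \<omega>)
    \<and> e2ennreal \<bar>hitting_time (signal_estimate s \<epsilon> B N) l \<omega> - hitting_time (signal s B) l \<omega>\<bar>
        \<le> ennreal (\<bar>B T \<omega> - Z \<epsilon> T \<omega>\<bar> / s) + (R \<omega> + Q \<omega>)"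
    using H K
  proof eventually_elim
    case (elim \<omega>)
    then obtain h k where h: "hitting_time (signal s B) l \<omega> = ereal h" "ennreal \<bar>h - (T - B T \<omega> / s)\<bar> \<le> R \<omega>"
      and k: "hitting_time (signal_estimate s \<epsilon> B N) l \<omega> = ereal k" "ennreal \<bar>k - (T - Z \<epsilon> T \<omega> / s)\<bar> \<le> Q \<omega>"
      by (auto simp: T_def)
    define e where "e = \<bar>h - (T - B T \<omega> / s)\<bar> + \<bar>k - (T - Z \<epsilon> T \<omega> / s)\<bar>"
    have "0 \<le> e" by (simp add: e_def)
    have "ennreal e \<le> R \<omega> + Q \<omega>"
      unfolding e_def by (subst ennreal_plus) (auto intro: add_mono h k)
    have d: "\<bar>B T \<omega> - Z \<epsilon> T \<omega>\<bar> / s = \<bar>B T \<omega> / s - Z \<epsilon> T \<omega> / s\<bar>"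
      using s by (simp flip: diff_divide_distrib)
    have "\<bar>B T \<omega> - Z \<epsilon> T \<omega>\<bar> / s \<le> \<bar>k - h\<bar> + e" unfolding d by (simp add: e_def)
    from ennreal_leI[OF this] have "ennreal (\<bar>B T \<omega> - Z \<epsilon> T \<omega>\<bar> / s) \<le> ennreal \<bar>k - h\<bar> + ennreal e"
      using \<open>0 \<le> e\<close> by simp
    moreover have "\<bar>k - h\<bar> \<le> \<bar>B T \<omega> - Z \<epsilon> T \<omega>\<bar> / s + e" unfolding d by (simp add: e_def)
    from ennreal_leI[OF this] have "ennreal \<bar>k - h\<bar> \<le> ennreal (\<bar>B T \<omega> - Z \<epsilon> T \<omega>\<bar> / s) + ennreal e"
      using \<open>0 \<le> e\<close> s by simp
    ultimately show ?case
      using add_left_mono[OF \<open>ennreal e \<le> R \<omega> + Q \<omega>\<close>] unfolding h(1) k(1) e2ennreal_abs_diff_ereal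
      by (meson order_trans)
  qed
  have "ennreal (error_rate l s \<epsilon>) \<le> hitting_error M B N l s \<epsilon> + (\<integral>\<^sup>+\<omega>. R \<omega> + Q \<omega> \<partial>M)"
    unfolding rate[symmetric] hitting_error_def mean_abs_error_def
    by (rule le_nn_integral_add) (use AE in auto)
  also have "\<dots> \<le> hitting_error M B N l s \<epsilon> + ennreal (2 * r)" by (intro add_left_mono intRQ)
  finally have "ennreal (error_rate l s \<epsilon>) - ennreal (2 * r) \<le> hitting_error M B N l s \<epsilon>"
    by (simp add: ennreal_minus_le_iff add.commute)
  then show "ennreal (error_rate l s \<epsilon> - 2 * r) \<le> hitting_error M B N l s \<epsilon>"
    using r by (simp add: ennreal_minus)
  have "hitting_error M B N l s \<epsilon> \<le> (\<integral>\<^sup>+\<omega>. ennreal (\<bar>B T \<omega> - Z \<epsilon> T \<omega>\<bar> / s) + (R \<omega> + Q \<omega>) \<partial>M)"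
    unfolding hitting_error_def mean_abs_error_def
    by (rule nn_integral_mono_AE) (use AE in auto)
  also have "\<dots> = ennreal (error_rate l s \<epsilon>) + (\<integral>\<^sup>+\<omega>. R \<omega> + Q \<omega> \<partial>M)"
    by (subst nn_integral_add) (auto simp: rate)
  also have "\<dots> \<le> ennreal (error_rate l s \<epsilon>) + ennreal (2 * r)" by (intro add_left_mono intRQ)
  also have "\<dots> = ennreal (error_rate l s \<epsilon> + 2 * r)"
    using r s l by (intro ennreal_plus[symmetric]) (auto simp: error_rate_def)
  finally show "hitting_error M B N l s \<epsilon> \<le> ennreal (error_rate l s \<epsilon> + 2 * r)" .
qed

end

section \<open>Explicit bounds around the claimed rate\<close>

lemma error_rate_pos: "0 < l \<Longrightarrow> 0 < s \<Longrightarrow> 0 < \<epsilon> \<Longrightarrow> 0 < error_rate l s \<epsilon>"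
  unfolding error_rate_def
  by (intro real_sqrt_gt_zero divide_pos_pos mult_pos_pos zero_less_power add_pos_nonneg) auto

context wiener_pair
begin

text \<open>
  The slope \<open>b\<close> balances the two contributions \<open>b * sqrt T / s\<^sup>2\<close> and \<open>1 / (s * b)\<close> to the error of the
  linearization; both equal \<open>sqrt (k * T) / s\<close> divided by \<open>sqrt A\<close>.
\<close>

lemma error_bounds:
  assumes \<epsilon>: "0 < \<epsilon>" and s: "0 < s" and l: "0 < l"
    and A: "4 \<le> A" "A = \<epsilon>\<^sup>2 / (1 + \<epsilon>\<^sup>2) * sqrt (s * l)"
  defines "\<rho> \<equiv> error_rate l s \<epsilon>"
  defines "\<delta> \<equiv> 10 ^ 7 * \<rho> / sqrt A"
  shows "ennreal (\<rho> - \<delta>) \<le> optimal_error M B N l s \<epsilon>" "optimal_error M B N l s \<epsilon> \<le> ennreal (\<rho> + \<delta>)"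
    and "ennreal (\<rho> - \<delta>) \<le> hitting_error M B N l s \<epsilon>" "hitting_error M B N l s \<epsilon> \<le> ennreal (\<rho> + \<delta>)"
proof -
  define T where "T = l / s"
  define k where "k = \<epsilon>\<^sup>2 / (1 + \<epsilon>\<^sup>2)"
  define b where "b = s * sqrt k / sqrt A"
  define r where "r = sqrt k * sqrt T / s"
  have T: "0 < T" using s l by (simp add: T_def)
  have k: "0 < k" "k \<le> 1" using \<epsilon> by (auto simp: k_def field_simps add_pos_nonneg)
  \<comment> \<open>The lower bound \<open>4\<close> makes the slope admissible for the
    linearization: with \<open>k \<le> 1\<close> it yields
    \<open>b \<le> s / sqrt A \<le> s / 2\<close>.\<close>
  have A0: "0 < A" and sA: "2 \<le> sqrt A" using A(1) real_le_rsqrt[of 2 A] by auto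
  have A_eq: "A = k * s * sqrt T"
  proof -
    have "s * l = s\<^sup>2 * T" using s by (simp add: T_def power2_eq_square)
    then have "sqrt (s * l) = s * sqrt T" using s by (simp add: real_sqrt_mult)
    then show ?thesis by (simp add: A(2) k_def)
  qed
  have b: "0 < b" using s k A0 by (simp add: b_def)
  have b2: "b \<le> s / 2"
  proof -
    have "b \<le> s * 1 / 2" unfolding b_def
      using s k sA by (intro frac_le mult_left_mono) auto
    then show ?thesis by simp
  qed
  have r: "0 < r" using k T s by (simp add: r_def)
  have bT: "b * sqrt T / s\<^sup>2 = r / sqrt A"
    using s by (simp add: b_def r_def power2_eq_square)
  have sb: "1 / (s * b) = r / sqrt A"
  proof -
    have "r / sqrt A * (s * b) = (sqrt k * sqrt k) * s * sqrt T / (sqrt A * sqrt A)"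
      using s by (simp add: b_def r_def)
    also have "\<dots> = 1" using k A0 by (simp add: A_eq[symmetric])
    finally show ?thesis using s b by (metis mult_eq_0_iff less_irrefl nonzero_eq_divide_eq)
  qed
  have \<rho>: "\<rho> = sqrt (2 / pi) * r"
  proof -
    have "r = sqrt (k * T / s\<^sup>2)" using s by (simp add: r_def real_sqrt_mult real_sqrt_divide)
    then have "sqrt (2 / pi) * r = sqrt (2 / pi * (k * T / s\<^sup>2))" by (simp only: real_sqrt_mult)
    also have "2 / pi * (k * T / s\<^sup>2) = 2 * l * \<epsilon>\<^sup>2 / (pi * s ^ 3 * (1 + \<epsilon>\<^sup>2))"
      using s by (simp add: k_def T_def power2_eq_square power3_eq_cube mult_ac)
    finally show ?thesis by (simp add: \<rho>_def error_rate_def)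
  qed
  \<comment> \<open>A crude comparison of \<open>r\<close> with the rate, so that the error terms
    become multiples of the rate.\<close>
  have "1 / 2 \<le> sqrt (2 / pi)" using pi_less_4 by (intro real_le_rsqrt) (simp add: power2_eq_square field_simps)
  then have r\<rho>: "r \<le> 2 * \<rho>" using mult_right_mono[of "1 / 2" "sqrt (2 / pi)" r] r by (simp add: \<rho>)
  \<comment> \<open>The common linearization cost of both hitting times: \<open>4\<close> comes from
    the slope term and \<open>16 * 10 ^ 5\<close> from the dominating variable. Its double, which
    \<open>hitting_error_bounds\<close> requires, still fits below the bound with
    \<open>10 ^ 7\<close>.\<close>
  define d where "d = (4 + 16 * 10 ^ 5) * (r / sqrt A)"
  have d: "0 \<le> d" using r A0 by (simp add: d_def)
  have "2 * d \<le> 10 ^ 7 * (r / 2) / sqrt A" using r A0 by (simp add: d_def field_simps)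
  also have "\<dots> \<le> \<delta>" unfolding \<delta>_def
    using r\<rho> A0 by (intro divide_right_mono mult_left_mono) auto
  finally have d\<delta>: "2 * d \<le> \<delta>" .
  \<comment> \<open>Slope \<open>b / 2\<close> for each of \<open>B\<close> and \<open>N\<close>, so
    that their sum dominates \<open>Z\<close> with slope \<open>b\<close>.\<close>
  obtain V where V: "V \<in> borel_measurable M" "(\<integral>\<^sup>+\<omega>. V \<omega> \<partial>M) \<le> ennreal (2 * 10 ^ 5 / (b / 2))"
      "AE \<omega> in M. \<forall>t\<ge>0. ennreal \<bar>B t \<omega> - B T \<omega>\<bar> \<le> ennreal (b / 2 * \<bar>t - T\<bar>) + V \<omega>"
    using B.two_sided_drift_domination[of T "b / 2"] T b by auto
  obtain V' where V': "V' \<in> borel_measurable M" "(\<integral>\<^sup>+\<omega>. V' \<omega> \<partial>M) \<le> ennreal (2 * 10 ^ 5 / (b / 2))"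
      "AE \<omega> in M. \<forall>t\<ge>0. ennreal \<bar>N t \<omega> - N T \<omega>\<bar> \<le> ennreal (b / 2 * \<bar>t - T\<bar>) + V' \<omega>"
    using N.two_sided_drift_domination[of T "b / 2"] T b by auto
  have intVV: "(\<integral>\<^sup>+\<omega>. V \<omega> + V' \<omega> \<partial>M) \<le> ennreal (8 * 10 ^ 5 / b)"
  proof -
    have "(\<integral>\<^sup>+\<omega>. V \<omega> + V' \<omega> \<partial>M) \<le> ennreal (2 * 10 ^ 5 / (b / 2)) + ennreal (2 * 10 ^ 5 / (b / 2))"
      using V V' by (subst nn_integral_add) (auto intro: add_mono)
    also have "\<dots> = ennreal (8 * 10 ^ 5 / b)" using b by (subst ennreal_plus[symmetric]) auto
    finally show ?thesis .
  qed
  \<comment> \<open>Weakened to the bound for the sum, so that both linearizations have the same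
    cost \<open>d\<close>.\<close>
  have intV: "(\<integral>\<^sup>+\<omega>. V \<omega> \<partial>M) \<le> ennreal (8 * 10 ^ 5 / b)"
    by (rule order_trans[OF _ intVV]) (simp add: nn_integral_mono)
  have err: "2 * b / s\<^sup>2 * (2 * sqrt T) + 2 / s * (8 * 10 ^ 5 / b) = d"
  proof -
    have "2 * b / s\<^sup>2 * (2 * sqrt T) + 2 / s * (8 * 10 ^ 5 / b) = 4 * (b * sqrt T / s\<^sup>2) + 16 * 10 ^ 5 * (1 / (s * b))"
      by simp
    then show ?thesis unfolding bT sb by (simp add: d_def)
  qed
  have mT: "B T \<in> borel_measurable M" "N T \<in> borel_measurable M" "Z \<epsilon> T \<in> borel_measurable M"
    using B.measurable_W N.measurable_W measurable_Z T by auto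
  have dom: "AE \<omega> in M. \<forall>t\<ge>0. ennreal \<bar>B t \<omega> - B T \<omega>\<bar> \<le> ennreal (b * \<bar>t - T\<bar>) + V \<omega>"
    using V(3)
  proof eventually_elim
    case (elim \<omega>)
    show ?case
    proof (intro allI impI)
      fix t :: real assume "0 \<le> t"
      then have "ennreal \<bar>B t \<omega> - B T \<omega>\<bar> \<le> ennreal (b / 2 * \<bar>t - T\<bar>) + V \<omega>" using elim by blast
      also have "\<dots> \<le> ennreal (b * \<bar>t - T\<bar>) + V \<omega>"
        using b by (intro add_right_mono ennreal_leI mult_right_mono) auto
      finally show "ennreal \<bar>B t \<omega> - B T \<omega>\<bar> \<le> ennreal (b * \<bar>t - T\<bar>) + V \<omega>" .
    qed
  qed
  have int_BT: "(\<integral>\<^sup>+\<omega>. ennreal \<bar>B T \<omega>\<bar> \<partial>M) \<le> ennreal (2 * sqrt T)"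
    using T by (intro order_trans[OF B.nn_integral_abs_le[OF T]] ennreal_leI) simp
  have "\<exists>R\<in>borel_measurable M. (\<integral>\<^sup>+\<omega>. R \<omega> \<partial>M) \<le> ennreal d \<and>
    (AE \<omega> in M. \<exists>h. hitting_time (signal s B) l \<omega> = ereal h \<and> ennreal \<bar>h - (T - B T \<omega> / s)\<bar> \<le> R \<omega>)"
    using B.hitting_time_near_linearization[of B l s b V "8 * 10 ^ 5 / b" "2 * sqrt T", folded T_def,
        OF mT(1) B.W_0 B.W_cont s l b b2 V(1) intV dom int_BT] b T
    unfolding err signal_eq by simp
  then obtain R where R: "R \<in> borel_measurable M" "(\<integral>\<^sup>+\<omega>. R \<omega> \<partial>M) \<le> ennreal d"
    "AE \<omega> in M. \<exists>h. hitting_time (signal s B) l \<omega> = ereal h \<and> ennreal \<bar>h - (l / s - B (l / s) \<omega> / s)\<bar> \<le> R \<omega>"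
    unfolding T_def by blast
  have dom_Z: "AE \<omega> in M. \<forall>t\<ge>0. ennreal \<bar>Z \<epsilon> t \<omega> - Z \<epsilon> T \<omega>\<bar> \<le> ennreal (b * \<bar>t - T\<bar>) + (V \<omega> + V' \<omega>)"
    using V(3) V'(3)
  proof eventually_elim
    case (elim \<omega>)
    show ?case
    proof (intro allI impI)
      fix t :: real assume t: "0 \<le> t"
      have "ennreal \<bar>Z \<epsilon> t \<omega> - Z \<epsilon> T \<omega>\<bar> \<le> ennreal \<bar>B t \<omega> - B T \<omega>\<bar> + ennreal \<bar>N t \<omega> - N T \<omega>\<bar>"
        using ennreal_leI[OF Z_diff_le] by simp
      also have "\<dots> \<le> (ennreal (b / 2 * \<bar>t - T\<bar>) + V \<omega>) + (ennreal (b / 2 * \<bar>t - T\<bar>) + V' \<omega>)"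
        using elim t by (intro add_mono) blast+
      also have "\<dots> = (ennreal (b / 2 * \<bar>t - T\<bar>) + ennreal (b / 2 * \<bar>t - T\<bar>)) + (V \<omega> + V' \<omega>)"
        by (simp only: ac_simps)
      also have "ennreal (b / 2 * \<bar>t - T\<bar>) + ennreal (b / 2 * \<bar>t - T\<bar>) = ennreal (b * \<bar>t - T\<bar>)"
        using b by (subst ennreal_plus[symmetric]) auto
      finally show "ennreal \<bar>Z \<epsilon> t \<omega> - Z \<epsilon> T \<omega>\<bar> \<le> ennreal (b * \<bar>t - T\<bar>) + (V \<omega> + V' \<omega>)" .
    qed
  qed
  have Z_0: "\<omega> \<in> space M \<Longrightarrow> Z \<epsilon> 0 \<omega> = 0" for \<omega> by (simp add: Z_def B.W_0 N.W_0)
  have Z_cont: "AE \<omega> in M. continuous_on {0..} (\<lambda>t. Z \<epsilon> t \<omega>)"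
    using B.W_cont N.W_cont
  proof eventually_elim
    case (elim \<omega>)
    have "1 + \<epsilon>\<^sup>2 \<noteq> 0" by (metis add_pos_nonneg less_irrefl zero_le_power2 zero_less_one)
    then show ?case unfolding Z_def by (intro continuous_intros elim) auto
  qed
  have int_ZT: "(\<integral>\<^sup>+\<omega>. ennreal \<bar>Z \<epsilon> T \<omega>\<bar> \<partial>M) \<le> ennreal (2 * sqrt T)"
  proof -
    have "(\<integral>\<^sup>+\<omega>. ennreal \<bar>Z \<epsilon> T \<omega>\<bar> \<partial>M) \<le> (\<integral>\<^sup>+\<omega>. ennreal \<bar>B T \<omega>\<bar> + ennreal \<bar>N T \<omega>\<bar> \<partial>M)"
    proof (rule nn_integral_mono)
      fix \<omega> assume "\<omega> \<in> space M"
      then have "\<bar>Z \<epsilon> T \<omega>\<bar> \<le> \<bar>B T \<omega>\<bar> + \<bar>N T \<omega>\<bar>"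
        using Z_diff_le[of \<epsilon> T \<omega> 0] Z_0 B.W_0 N.W_0 by simp
      from ennreal_leI[OF this] show "ennreal \<bar>Z \<epsilon> T \<omega>\<bar> \<le> ennreal \<bar>B T \<omega>\<bar> + ennreal \<bar>N T \<omega>\<bar>" by simp
    qed
    also have "\<dots> = (\<integral>\<^sup>+\<omega>. ennreal \<bar>B T \<omega>\<bar> \<partial>M) + (\<integral>\<^sup>+\<omega>. ennreal \<bar>N T \<omega>\<bar> \<partial>M)"
      using mT by (intro nn_integral_add) auto
    also have "\<dots> \<le> ennreal (sqrt T) + ennreal (sqrt T)"
      by (intro add_mono B.nn_integral_abs_le N.nn_integral_abs_le T)
    also have "\<dots> = ennreal (2 * sqrt T)" using T by (subst ennreal_plus[symmetric]) auto
    finally show ?thesis .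
  qed
  have VV': "(\<lambda>\<omega>. V \<omega> + V' \<omega>) \<in> borel_measurable M" using V V' by auto
  have "\<exists>R\<in>borel_measurable M. (\<integral>\<^sup>+\<omega>. R \<omega> \<partial>M) \<le> ennreal d \<and>
    (AE \<omega> in M. \<exists>h. hitting_time (signal_estimate s \<epsilon> B N) l \<omega> = ereal h \<and> ennreal \<bar>h - (T - Z \<epsilon> T \<omega> / s)\<bar> \<le> R \<omega>)"
    using B.hitting_time_near_linearization[of "Z \<epsilon>" l s b "\<lambda>\<omega>. V \<omega> + V' \<omega>" "8 * 10 ^ 5 / b" "2 * sqrt T", folded T_def,
        OF mT(3) Z_0 Z_cont s l b b2 VV' intVV dom_Z int_ZT] b T
    unfolding err signal_estimate_eq by simp
  then obtain Q where Q: "Q \<in> borel_measurable M" "(\<integral>\<^sup>+\<omega>. Q \<omega> \<partial>M) \<le> ennreal d"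
    "AE \<omega> in M. \<exists>h. hitting_time (signal_estimate s \<epsilon> B N) l \<omega> = ereal h \<and> ennreal \<bar>h - (l / s - Z \<epsilon> (l / s) \<omega> / s)\<bar> \<le> Q \<omega>"
    unfolding T_def by blast
  show "ennreal (\<rho> - \<delta>) \<le> optimal_error M B N l s \<epsilon>"
    using d\<delta> d by (intro order_trans[OF _ optimal_error_lower[OF \<epsilon> s l R d]] ennreal_leI) (simp add: \<rho>_def)
  show "optimal_error M B N l s \<epsilon> \<le> ennreal (\<rho> + \<delta>)"
    using d\<delta> d by (intro order_trans[OF optimal_error_upper[OF \<epsilon> s l R d]] ennreal_leI) (simp add: \<rho>_def)
  show "ennreal (\<rho> - \<delta>) \<le> hitting_error M B N l s \<epsilon>"
    using d\<delta> by (intro order_trans[OF _ hitting_error_bounds(1)[OF \<epsilon> s l R Q d]] ennreal_leI) (simp add: \<rho>_def)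
  show "hitting_error M B N l s \<epsilon> \<le> ennreal (\<rho> + \<delta>)"
    using d\<delta> by (intro order_trans[OF hitting_error_bounds(2)[OF \<epsilon> s l R Q d]] ennreal_leI) (simp add: \<rho>_def)
qed

end

section \<open>Quotients tending to one in the extended nonnegative reals\<close>

lemma asymp_eq_sandwich:
  fixes f :: "'i \<Rightarrow> ennreal" and \<rho> e :: "'i \<Rightarrow> real"
  assumes \<rho>: "\<forall>\<^sub>F i in F. 0 < \<rho> i" and e: "(e \<longlongrightarrow> 0) F"
    and le: "\<forall>\<^sub>F i in F. ennreal (\<rho> i * (1 - e i)) \<le> f i \<and> f i \<le> ennreal (\<rho> i * (1 + e i))"
  shows "asymp_eq f F (\<lambda>i. ennreal (\<rho> i))"
  unfolding asymp_eq_def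
proof (rule tendsto_sandwich)
  \<comment> \<open>Negative \<open>x\<close> must be allowed, since \<open>1 - e i\<close> may be
    negative; both sides are then \<open>0\<close>.\<close>
  have div: "ennreal (\<rho> * x) / ennreal \<rho> = ennreal x" if "0 < \<rho>" for \<rho> x :: real
    using that by (cases "0 \<le> x") (auto simp: divide_ennreal ennreal_neg mult_nonneg_nonpos)
  show "\<forall>\<^sub>F i in F. ennreal (1 - e i) \<le> f i / ennreal (\<rho> i)"
    using \<rho> le by eventually_elim (metis div divide_right_mono_ennreal)
  show "\<forall>\<^sub>F i in F. f i / ennreal (\<rho> i) \<le> ennreal (1 + e i)"
    using \<rho> le by eventually_elim (metis div divide_right_mono_ennreal)
  have "((\<lambda>i. ennreal (1 - e i)) \<longlongrightarrow> ennreal (1 - 0)) F" by (intro tendsto_intros e tendsto_ennrealI)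
  then show "((\<lambda>i. ennreal (1 - e i)) \<longlongrightarrow> 1) F" by simp
  have "((\<lambda>i. ennreal (1 + e i)) \<longlongrightarrow> ennreal (1 + 0)) F" by (intro tendsto_intros e tendsto_ennrealI)
  then show "((\<lambda>i. ennreal (1 + e i)) \<longlongrightarrow> 1) F" by simp
qed

text \<open>The quotient of two ratios that tend to \<open>1\<close>. It is formed in the reals,
  where division is continuous at \<open>1\<close>; this is legitimate because eventually both
  ratios are finite and the second is positive.\<close>

lemma asymp_eq_common:
  fixes f g :: "'i \<Rightarrow> ennreal" and \<rho> :: "'i \<Rightarrow> real"
  assumes \<rho>: "\<forall>\<^sub>F i in F. 0 < \<rho> i"
    and f: "asymp_eq f F (\<lambda>i. ennreal (\<rho> i))" and g: "asymp_eq g F (\<lambda>i. ennreal (\<rho> i))"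
  shows "asymp_eq f F g"
proof -
  let ?h = "\<lambda>i. enn2real (f i / ennreal (\<rho> i)) / enn2real (g i / ennreal (\<rho> i))"
  have "(?h \<longlongrightarrow> enn2real 1 / enn2real 1) F"
    using f g unfolding asymp_eq_def by (intro tendsto_divide tendsto_enn2real) auto
  then have "((\<lambda>i. ennreal (?h i)) \<longlongrightarrow> ennreal (enn2real 1 / enn2real 1)) F"
    by (rule tendsto_ennrealI)
  then have lim: "((\<lambda>i. ennreal (?h i)) \<longlongrightarrow> 1) F" by simp
  have "\<forall>\<^sub>F i in F. f i / ennreal (\<rho> i) < 2" "\<forall>\<^sub>F i in F. g i / ennreal (\<rho> i) < 2" "\<forall>\<^sub>F i in F. 0 < g i / ennreal (\<rho> i)"
    using f g unfolding asymp_eq_def by (auto intro: order_tendstoD)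
  then have "\<forall>\<^sub>F i in F. ennreal (?h i) = f i / g i"
    using \<rho>
  proof eventually_elim
    case (elim i)
    obtain a where a: "f i = ennreal a" "0 \<le> a"
      using elim by (cases "f i") (auto simp: ennreal_top_divide)
    obtain c where c: "g i = ennreal c" "0 \<le> c"
      using elim by (cases "g i") (auto simp: ennreal_top_divide)
    have "c \<noteq> 0" using elim(3) c by auto
    with a c elim(4) show ?case by (simp add: divide_ennreal)
  qed
  from filterlim_cong[OF refl refl this] lim show ?thesis unfolding asymp_eq_def by simp
qed

text \<open>By \<open>error_bounds\<close> both errors agree with the rate up to a relative
  deviation of \<open>10 ^ 7 / sqrt (a i)\<close>, which vanishes as \<open>a\<close> grows.
  Comparison with the common rate relates the two errors to each other.\<close>

lemma (in wiener_pair) error_asymptotics: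
  fixes F :: "'i filter" and l s \<epsilon> :: "'i \<Rightarrow> real"
  assumes pos: "\<forall>\<^sub>F i in F. 0 < l i \<and> 0 < s i \<and> 0 < \<epsilon> i"
    and A: "filterlim (\<lambda>i. (\<epsilon> i)\<^sup>2 / (1 + (\<epsilon> i)\<^sup>2) * sqrt (s i * l i)) at_top F"
  shows "asymp_eq (\<lambda>i. optimal_error M B N (l i) (s i) (\<epsilon> i)) F (\<lambda>i. hitting_error M B N (l i) (s i) (\<epsilon> i))"
    and "asymp_eq (\<lambda>i. hitting_error M B N (l i) (s i) (\<epsilon> i)) F (\<lambda>i. ennreal (error_rate (l i) (s i) (\<epsilon> i)))"
proof -
  define a where "a i = (\<epsilon> i)\<^sup>2 / (1 + (\<epsilon> i)\<^sup>2) * sqrt (s i * l i)" for i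
  define e where "e i = 10 ^ 7 / sqrt (a i)" for i
  define \<rho> where "\<rho> i = error_rate (l i) (s i) (\<epsilon> i)" for i
  have a: "filterlim a at_top F" using A by (simp add: a_def[abs_def])
  have "filterlim (\<lambda>i. sqrt (a i)) at_top F" by (rule filterlim_compose[OF sqrt_at_top a])
  then have e: "(e \<longlongrightarrow> 0) F"
    unfolding e_def[abs_def] by (intro tendsto_divide_0[OF tendsto_const] filterlim_at_top_imp_at_infinity)
  have \<rho>: "\<forall>\<^sub>F i in F. 0 < \<rho> i"
    using pos by eventually_elim (simp add: \<rho>_def error_rate_pos)
  have "\<forall>\<^sub>F i in F. 4 \<le> a i" using a by (simp add: filterlim_at_top)
  then have bounds: "\<forall>\<^sub>F i in F.
      (ennreal (\<rho> i * (1 - e i)) \<le> optimal_error M B N (l i) (s i) (\<epsilon> i) \<and>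
       optimal_error M B N (l i) (s i) (\<epsilon> i) \<le> ennreal (\<rho> i * (1 + e i))) \<and>
      (ennreal (\<rho> i * (1 - e i)) \<le> hitting_error M B N (l i) (s i) (\<epsilon> i) \<and>
       hitting_error M B N (l i) (s i) (\<epsilon> i) \<le> ennreal (\<rho> i * (1 + e i)))"
    using pos
  proof eventually_elim
    case (elim i)
    have "\<rho> i * (1 - e i) = \<rho> i - 10 ^ 7 * \<rho> i / sqrt (a i)" "\<rho> i * (1 + e i) = \<rho> i + 10 ^ 7 * \<rho> i / sqrt (a i)"
      by (simp_all add: e_def algebra_simps)
    then show ?case
      using error_bounds[of "\<epsilon> i" "s i" "l i" "a i"] elim by (simp add: a_def \<rho>_def)
  qed
  have optimal: "asymp_eq (\<lambda>i. optimal_error M B N (l i) (s i) (\<epsilon> i)) F (\<lambda>i. ennreal (\<rho> i))"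
    by (rule asymp_eq_sandwich[OF \<rho> e]) (use bounds in eventually_elim, blast)
  have hitting: "asymp_eq (\<lambda>i. hitting_error M B N (l i) (s i) (\<epsilon> i)) F (\<lambda>i. ennreal (\<rho> i))"
    by (rule asymp_eq_sandwich[OF \<rho> e]) (use bounds in eventually_elim, blast)
  then show "asymp_eq (\<lambda>i. hitting_error M B N (l i) (s i) (\<epsilon> i)) F (\<lambda>i. ennreal (error_rate (l i) (s i) (\<epsilon> i)))"
    by (simp add: \<rho>_def)
  show "asymp_eq (\<lambda>i. optimal_error M B N (l i) (s i) (\<epsilon> i)) F (\<lambda>i. hitting_error M B N (l i) (s i) (\<epsilon> i))"
    by (rule asymp_eq_common[OF \<rho> optimal hitting])
qed

theorem theorem2p6:
  fixes M :: "'a measure" and B N :: "real \<Rightarrow> 'a \<Rightarrow> real" and q :: real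
  assumes "standard_wiener M B" and "standard_wiener M N" and "indep_processes M B N"
    and "1 / 2 < q" and "q < 1"
  shows
    "(\<forall>(F :: 'i filter) (l :: 'i \<Rightarrow> real) (s :: 'i \<Rightarrow> real) (\<epsilon> :: 'i \<Rightarrow> real).
        (\<forall>i. 0 < l i \<and> 0 < s i \<and> 0 < \<epsilon> i) \<longrightarrow>
        filterlim (\<lambda>i. s i * (l i / s i) powr (q - 1 / 2)) at_top F \<longrightarrow>
        filterlim (\<lambda>i. (l i / s i) powr (1 - q) * ((\<epsilon> i)\<^sup>2 / (1 + (\<epsilon> i)\<^sup>2))) at_top F \<longrightarrow>
        filterlim (\<lambda>i. s i * l i * ((\<epsilon> i) ^ 4 / (1 + (\<epsilon> i)\<^sup>2)\<^sup>2)) at_top F \<longrightarrow>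
        asymp_eq (\<lambda>i. optimal_error M B N (l i) (s i) (\<epsilon> i)) F
                 (\<lambda>i. hitting_error M B N (l i) (s i) (\<epsilon> i)) \<and>
        asymp_eq (\<lambda>i. hitting_error M B N (l i) (s i) (\<epsilon> i)) F
                 (\<lambda>i. ennreal (error_rate (l i) (s i) (\<epsilon> i))))
   \<and> (\<forall>(s :: real) (\<epsilon> :: real). 0 < s \<longrightarrow> 0 < \<epsilon> \<longrightarrow>
        asymp_eq (\<lambda>l. optimal_error M B N l s \<epsilon>) at_top (\<lambda>l. hitting_error M B N l s \<epsilon>) \<and>
        asymp_eq (\<lambda>l. hitting_error M B N l s \<epsilon>) at_top (\<lambda>l. ennreal (error_rate l s \<epsilon>)))"
proof -
  interpret B: wiener M B by standard (rule assms(1))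
  interpret N: wiener M N by standard (rule assms(2))
  interpret wiener_pair M B N by standard (rule assms(3))
  show ?thesis
  proof (intro conjI allI impI)
    fix F :: "'i filter" and l s \<epsilon> :: "'i \<Rightarrow> real"
    assume pos: "\<forall>i. 0 < l i \<and> 0 < s i \<and> 0 < \<epsilon> i"
      and lim: "filterlim (\<lambda>i. s i * l i * ((\<epsilon> i) ^ 4 / (1 + (\<epsilon> i)\<^sup>2)\<^sup>2)) at_top F"
    \<comment> \<open>The quantity in the third limit is the square of the \<open>A\<close> of
      \<open>error_bounds\<close>.\<close>
    have "sqrt (s i * l i * ((\<epsilon> i) ^ 4 / (1 + (\<epsilon> i)\<^sup>2)\<^sup>2)) = (\<epsilon> i)\<^sup>2 / (1 + (\<epsilon> i)\<^sup>2) * sqrt (s i * l i)" for i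
    proof -
      have "(\<epsilon> i) ^ 4 / (1 + (\<epsilon> i)\<^sup>2)\<^sup>2 = ((\<epsilon> i)\<^sup>2 / (1 + (\<epsilon> i)\<^sup>2))\<^sup>2" by (simp add: power_divide)
      moreover have "0 \<le> (\<epsilon> i)\<^sup>2 / (1 + (\<epsilon> i)\<^sup>2)" by simp
      ultimately show ?thesis by (simp only: real_sqrt_mult real_sqrt_abs abs_of_nonneg mult.commute)
    qed
    then have A: "filterlim (\<lambda>i. (\<epsilon> i)\<^sup>2 / (1 + (\<epsilon> i)\<^sup>2) * sqrt (s i * l i)) at_top F"
      using filterlim_compose[OF sqrt_at_top lim] by simp
    note lims = error_asymptotics[OF always_eventually[OF pos] A]
    show "asymp_eq (\<lambda>i. optimal_error M B N (l i) (s i) (\<epsilon> i)) F (\<lambda>i. hitting_error M B N (l i) (s i) (\<epsilon> i))"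
      by (rule lims(1))
    show "asymp_eq (\<lambda>i. hitting_error M B N (l i) (s i) (\<epsilon> i)) F (\<lambda>i. ennreal (error_rate (l i) (s i) (\<epsilon> i)))"
      by (rule lims(2))
  next
    fix s \<epsilon> :: real assume s: "0 < s" and \<epsilon>: "0 < \<epsilon>"
    have pos: "\<forall>\<^sub>F l :: real in at_top. 0 < l \<and> 0 < s \<and> 0 < \<epsilon>"
      using s \<epsilon> by (intro eventually_mono[OF eventually_gt_at_top[of 0]]) auto
    have k: "0 < \<epsilon>\<^sup>2 / (1 + \<epsilon>\<^sup>2)" using \<epsilon> by (simp add: add_pos_nonneg)
    \<comment> \<open>For fixed \<open>s\<close> and \<epsilon> the quantity \<open>A\<close> is a
      positive constant times \<open>sqrt l\<close>.\<close>
    have "filterlim (\<lambda>l. s * l) at_top at_top"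
      by (rule filterlim_tendsto_pos_mult_at_top[OF tendsto_const s filterlim_ident])
    then have A: "filterlim (\<lambda>l. \<epsilon>\<^sup>2 / (1 + \<epsilon>\<^sup>2) * sqrt (s * l)) at_top at_top"
      by (rule filterlim_tendsto_pos_mult_at_top[OF tendsto_const k filterlim_compose[OF sqrt_at_top]])
    note lims = error_asymptotics[where F=at_top and l="\<lambda>l. l" and s="\<lambda>_. s" and \<epsilon>="\<lambda>_. \<epsilon>", OF pos A]
    show "asymp_eq (\<lambda>l. optimal_error M B N l s \<epsilon>) at_top (\<lambda>l. hitting_error M B N l s \<epsilon>)"
      by (rule lims(1))
    show "asymp_eq (\<lambda>l. hitting_error M B N l s \<epsilon>) at_top (\<lambda>l. ennreal (error_rate l s \<epsilon>))"
      by (rule lims(2))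
  qed
qed

end
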